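(* Assume that pseudorandom function families exist. Then no algorithm decides $MC_{TT}$ in time $2^{O(n)}$, where the input is the truth table (of length $2^n$) of a function $f\in B_n$ together with a target $s\in\mathbb{N}$, and the question is whether $c_\wedge(f)\le s$.
   Context: $B_n$ denotes the set of Boolean functions $\mathbb{F}_2^n\to\mathbb{F}_2$. An XOR-AND circuit is a Boolean circuit with fan-in 2 over the basis $(\land,\oplus,1)$ (i.e. AND gates, XOR gates and the constant $1$; arithmetic over $\mathbb{F}_2$). The multiplicative complexity $c_\wedge(f)$ of $f\in B_n$ is the smallest number of AND gates in an XOR-AND circuit computing $f$. The decision problem $MC_{TT}$: given the truth table of $f\in B_n$ (a string of length $2^n$) and $s\in\mathbb{N}$, decide whether $c_\wedge(f)\le s$. A family $\{f_n\}_{n\in\mathbb{N}}$ with $f_n:\{0,1\}^n\times\{0,1\}^n\to\{0,1\}$ is a pseudorandom function family if $f$ is computable in polynomial time and for every probabilistic polynomial-time oracle Turing machine $A$, $\left|\Pr_{k\in_R\{0,1\}^n}[A^{f_n(k,\cdot)}(1^n)=1]-\Pr_{g\in_R B_n}[A^{g}(1^n)=1]\right|\le n^{-\omega(1)}$, where $\in_R$ means chosen uniformly at random and $A^H$ means $A$ has oracle access to $H$. *)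

theory Defs
  imports
    "HOL-Probability.Probability"
    "HOL-Library.FuncSet"
    "HOL-Library.Landau_Symbols"
    "HOL-Computational_Algebra.Polynomial"
begin

section \<open>Boolean functions and multiplicative complexity\<close>

text \<open>
  \<open>bool\<close> plays the role of both \<open>{0,1}\<close> and the field with two elements: conjunction is the
  product and inequality is the sum. Vectors of dimension \<open>n\<close> are the lists of length \<open>n\<close>.
\<close>

definition cube :: "nat \<Rightarrow> bool list set" where
  "cube n = {x. length x = n}"

definition bool_funs :: "nat \<Rightarrow> (bool list \<Rightarrow> bool) set" where
  "bool_funs n = cube n \<rightarrow>\<^sub>E (UNIV :: bool set)"

datatype gate = AndG nat nat | XorG nat nat | OneG

text \<open>
  A circuit with \<open>n\<close> inputs is a list of gates in topological order together with its output wire.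
  Wires \<open>0, \<dots>, n - 1\<close> carry the inputs and wire \<open>n + i\<close> carries the value of the \<open>i\<close>-th gate.
\<close>

type_synonym circuit = "gate list \<times> nat"

fun gate_wf :: "nat \<Rightarrow> gate \<Rightarrow> bool" where
  "gate_wf w (AndG i j) \<longleftrightarrow> i < w \<and> j < w"
| "gate_wf w (XorG i j) \<longleftrightarrow> i < w \<and> j < w"
| "gate_wf w OneG \<longleftrightarrow> True"

definition circuit_wf :: "nat \<Rightarrow> circuit \<Rightarrow> bool" where
  "circuit_wf n C \<longleftrightarrow>
     (\<forall>i < length (fst C). gate_wf (n + i) (fst C ! i)) \<and> snd C < n + length (fst C)"

fun gate_val :: "bool list \<Rightarrow> gate \<Rightarrow> bool" where
  "gate_val vs (AndG i j) \<longleftrightarrow> vs ! i \<and> vs ! j"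
| "gate_val vs (XorG i j) \<longleftrightarrow> vs ! i \<noteq> vs ! j"
| "gate_val vs OneG \<longleftrightarrow> True"

definition circuit_val :: "circuit \<Rightarrow> bool list \<Rightarrow> bool" where
  "circuit_val C x = foldl (\<lambda>vs g. vs @ [gate_val vs g]) x (fst C) ! snd C"

definition computes :: "nat \<Rightarrow> circuit \<Rightarrow> (bool list \<Rightarrow> bool) \<Rightarrow> bool" where
  "computes n C f \<longleftrightarrow> circuit_wf n C \<and> (\<forall>x \<in> cube n. circuit_val C x = f x)"

definition and_count :: "circuit \<Rightarrow> nat" where
  "and_count C = length (filter (\<lambda>g. \<exists>i j. g = AndG i j) (fst C))"

definition mult_complexity :: "nat \<Rightarrow> (bool list \<Rightarrow> bool) \<Rightarrow> nat" where
  "mult_complexity n f = (LEAST a. \<exists>C. computes n C f \<and> and_count C = a)"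


section \<open>Turing machines\<close>

text \<open>
  Multitape machines with two-way infinite tapes. Tape symbols and states are initial segments of
  the natural numbers.
\<close>

abbreviation blank :: nat where "blank \<equiv> 0"
abbreviation sep :: nat where "sep \<equiv> 3"

definition bit_sym :: "bool \<Rightarrow> nat" where
  "bit_sym b = (if b then 2 else 1)"

abbreviation start_state :: nat where "start_state \<equiv> 0"
abbreviation accept_state :: nat where "accept_state \<equiv> 1"
abbreviation reject_state :: nat where "reject_state \<equiv> 2"

datatype move = Move_Left | Stay | Move_Right

fun move_offset :: "move \<Rightarrow> int" where
  "move_offset Move_Left = -1"
| "move_offset Stay = 0"
| "move_offset Move_Right = 1"

type_synonym transition = "nat \<Rightarrow> nat list \<Rightarrow> nat \<times> (nat \<times> move) list"

record tm =
  ntapes :: nat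
  nstates :: nat
  nsyms :: nat
  delta :: transition

definition transition_wf :: "nat \<Rightarrow> nat \<Rightarrow> nat \<Rightarrow> transition \<Rightarrow> bool" where
  "transition_wf K Q G d \<longleftrightarrow>
     (\<forall>q rs. q < Q \<and> length rs = K \<and> set rs \<subseteq> {..<G} \<longrightarrow>
        fst (d q rs) < Q \<and> length (snd (d q rs)) = K \<and> fst ` set (snd (d q rs)) \<subseteq> {..<G})"

definition tm_wf :: "tm \<Rightarrow> bool" where
  "tm_wf M \<longleftrightarrow> ntapes M \<ge> 1 \<and> nstates M \<ge> 3 \<and> nsyms M \<ge> 4 \<and>
     transition_wf (ntapes M) (nstates M) (nsyms M) (delta M)"

text \<open>A tape is given by its contents and its head position, a configuration by state and tapes.\<close>

type_synonym tape = "(int \<Rightarrow> nat) \<times> int"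
type_synonym config = "nat \<times> tape list"

definition act :: "nat \<times> move \<Rightarrow> tape \<Rightarrow> tape" where
  "act a tp = ((fst tp)(snd tp := fst a), snd tp + move_offset (snd a))"

definition apply_transition :: "transition \<Rightarrow> config \<Rightarrow> config" where
  "apply_transition d c =
     (let (q, as) = d (fst c) (map (\<lambda>tp. fst tp (snd tp)) (snd c)) in (q, map2 act as (snd c)))"

definition halted :: "config \<Rightarrow> bool" where
  "halted c \<longleftrightarrow> fst c = accept_state \<or> fst c = reject_state"

definition accepting :: "config \<Rightarrow> bool" where
  "accepting c \<longleftrightarrow> fst c = accept_state"

definition input_tape :: "nat list \<Rightarrow> tape" where
  "input_tape w = ((\<lambda>p. if 0 \<le> p \<and> p < int (length w) then w ! nat p else blank), 0)"

definition init_config :: "nat \<Rightarrow> nat list \<Rightarrow> config" where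
  "init_config K w = (start_state, input_tape w # replicate (K - 1) (input_tape []))"

definition tm_step :: "tm \<Rightarrow> config \<Rightarrow> config" where
  "tm_step M c = (if halted c then c else apply_transition (delta M) c)"

definition tm_run :: "tm \<Rightarrow> nat \<Rightarrow> nat list \<Rightarrow> config" where
  "tm_run M t w = (tm_step M ^^ t) (init_config (ntapes M) w)"

text \<open>Halted configurations are fixed points of a step, so this bounds the halting time by \<open>t\<close>.\<close>

definition answers_within :: "tm \<Rightarrow> nat \<Rightarrow> nat list \<Rightarrow> bool \<Rightarrow> bool" where
  "answers_within M t w b \<longleftrightarrow> halted (tm_run M t w) \<and> (accepting (tm_run M t w) \<longleftrightarrow> b)"


section \<open>Probabilistic oracle Turing machines\<close>

text \<open>
  A probabilistic machine has a second transition function; a fair coin flipped in every step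
  determines which of the two is applied. In the query state the machine instead moves, in one
  step and without changing the tapes, to the yes or no state according to the oracle's answer on
  the word on tape 1. This word starts at position 0 and extends to the first blank; if it is not
  a bit string, the answer is no.
\<close>

record potm = tm + delta' :: transition

abbreviation query_state :: nat where "query_state \<equiv> 3"
abbreviation yes_state :: nat where "yes_state \<equiv> 4"
abbreviation no_state :: nat where "no_state \<equiv> 5"

definition potm_wf :: "potm \<Rightarrow> bool" where
  "potm_wf A \<longleftrightarrow> ntapes A \<ge> 2 \<and> nstates A \<ge> 6 \<and> nsyms A \<ge> 4 \<and>
     transition_wf (ntapes A) (nstates A) (nsyms A) (delta A) \<and>
     transition_wf (ntapes A) (nstates A) (nsyms A) (delta' A)"

definition holds_word :: "tape \<Rightarrow> bool list \<Rightarrow> bool" where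
  "holds_word tp x \<longleftrightarrow>
     (\<forall>i < length x. fst tp (int i) = bit_sym (x ! i)) \<and> fst tp (int (length x)) = blank"

definition oracle_answer :: "(bool list \<Rightarrow> bool) \<Rightarrow> tape \<Rightarrow> bool" where
  "oracle_answer H tp \<longleftrightarrow> (\<exists>x. holds_word tp x \<and> H x)"

definition potm_step :: "potm \<Rightarrow> (bool list \<Rightarrow> bool) \<Rightarrow> bool \<Rightarrow> config \<Rightarrow> config" where
  "potm_step A H coin c =
     (if halted c then c
      else if fst c = query_state
        then (if oracle_answer H (snd c ! 1) then yes_state else no_state, snd c)
      else apply_transition (if coin then delta' A else delta A) c)"

definition potm_run :: "potm \<Rightarrow> (bool list \<Rightarrow> bool) \<Rightarrow> nat \<Rightarrow> bool list \<Rightarrow> config pmf" where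
  "potm_run A H t w =
     ((\<lambda>P. bind_pmf P (\<lambda>c. map_pmf (\<lambda>coin. potm_step A H coin c) (bernoulli_pmf (1/2)))) ^^ t)
       (return_pmf (init_config (ntapes A) (map bit_sym w)))"

definition polytime_potm :: "potm \<Rightarrow> bool" where
  "polytime_potm A \<longleftrightarrow> potm_wf A \<and>
     (\<exists>p :: nat poly. \<forall>w H. \<forall>c \<in> set_pmf (potm_run A H (poly p (length w)) w). halted c)"

text \<open>
  The probability, over the choice of the oracle and the coins of \<open>A\<close>, that \<open>A\<close> accepts \<open>w\<close>.
  Acceptance within \<open>t\<close> steps is monotone in \<open>t\<close>.
\<close>

definition accept_prob :: "potm \<Rightarrow> (bool list \<Rightarrow> bool) pmf \<Rightarrow> bool list \<Rightarrow> real" where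
  "accept_prob A HD w =
     (SUP t. measure_pmf.prob (bind_pmf HD (\<lambda>H. potm_run A H t w)) {c. accepting c})"


section \<open>Pseudorandom function families\<close>

definition polytime_family :: "(nat \<Rightarrow> bool list \<Rightarrow> bool list \<Rightarrow> bool) \<Rightarrow> bool" where
  "polytime_family f \<longleftrightarrow>
     (\<exists>M (p :: nat poly). tm_wf M \<and>
        (\<forall>n. \<forall>k \<in> cube n. \<forall>x \<in> cube n.
           answers_within M (poly p n) (map bit_sym k @ [sep] @ map bit_sym x) (f n k x)))"

text \<open>Queries outside the domain of a function in \<open>n\<close> variables are answered negatively.\<close>

definition oracle_of :: "nat \<Rightarrow> (bool list \<Rightarrow> bool) \<Rightarrow> bool list \<Rightarrow> bool" where
  "oracle_of n g x \<longleftrightarrow> x \<in> cube n \<and> g x"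

definition advantage :: "(nat \<Rightarrow> bool list \<Rightarrow> bool list \<Rightarrow> bool) \<Rightarrow> potm \<Rightarrow> nat \<Rightarrow> real" where
  "advantage f A n =
     \<bar>accept_prob A (map_pmf (\<lambda>k. oracle_of n (f n k)) (pmf_of_set (cube n))) (replicate n True)
      - accept_prob A (map_pmf (oracle_of n) (pmf_of_set (bool_funs n))) (replicate n True)\<bar>"

text \<open>
  Being at most \<open>n\<close> to the power \<open>-\<omega>(1)\<close>. Divergence to infinity is used for \<open>\<omega>(1)\<close> because the
  Landau symbol of the library only looks at absolute values.
\<close>

definition superpoly_small :: "(nat \<Rightarrow> real) \<Rightarrow> bool" where
  "superpoly_small e \<longleftrightarrow>
     (\<exists>h :: nat \<Rightarrow> real. filterlim h at_top sequentially \<and>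
        (\<forall>\<^sub>F n in sequentially. e n \<le> real n powr (- h n)))"

definition pseudorandom_family :: "(nat \<Rightarrow> bool list \<Rightarrow> bool list \<Rightarrow> bool) \<Rightarrow> bool" where
  "pseudorandom_family f \<longleftrightarrow>
     polytime_family f \<and> (\<forall>A. polytime_potm A \<longrightarrow> superpoly_small (advantage f A))"


section \<open>The decision problem\<close>

text \<open>Entry \<open>i\<close> of the truth table is the value at \<open>x\<close> with \<open>i = (\<Sum>j<n. x\<^sub>j * 2 ^ j)\<close>.\<close>

definition truth_table :: "nat \<Rightarrow> (bool list \<Rightarrow> bool) \<Rightarrow> bool list" where
  "truth_table n f = map f (List.n_lists n [False, True])"

text \<open>Binary representation, most significant bit first, without leading zeros.\<close>

fun binary :: "nat \<Rightarrow> bool list" where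
  "binary s = (if s = 0 then [] else binary (s div 2) @ [odd s])"

declare binary.simps [simp del]

definition MC_TT_input :: "nat \<Rightarrow> (bool list \<Rightarrow> bool) \<Rightarrow> nat \<Rightarrow> nat list" where
  "MC_TT_input n f s = map bit_sym (truth_table n f) @ [sep] @ map bit_sym (binary s)"

definition decides_MC_TT :: "tm \<Rightarrow> (nat \<Rightarrow> nat) \<Rightarrow> bool" where
  "decides_MC_TT M T \<longleftrightarrow> tm_wf M \<and>
     (\<forall>n. \<forall>f \<in> bool_funs n. \<forall>s.
        answers_within M (T n) (MC_TT_input n f s) (mult_complexity n f \<le> s))"

end

theory Submission
  imports Defs
begin

text \<open>
  Given a decision procedure running in time \<open>2 ^ O(n)\<close>, the distinguisher restricts its oracle to
  the first \<open>m = 3 c log n\<close> variables, writes down the truth table, of polynomial length, and asks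
  whether the multiplicative complexity is at most \<open>2 ^ (m / 3)\<close>, which is at least \<open>n ^ c\<close>. A member
  of the pseudorandom family is computed by a Turing machine in polynomial time, and simulating that
  machine takes polynomially many products, so the answer is yes once \<open>c\<close> is large. For a random
  function it is almost always no: a function with \<open>s\<close> products is a sum of inputs, 1 and products
  of two earlier such sums, hence there are at most \<open>2 ^ ((2 s + 1) (m + 1 + s))\<close> of them, far
  fewer than \<open>2 ^ 2 ^ m\<close>.
\<close>

section \<open>Spans of iterated products\<close>

text \<open>The divisor 3 comes from the count: for \<open>s\<close> products its exponent is about
  \<open>2 * s ^ 2\<close>, while with \<open>s = 2 ^ (m / 3)\<close> the exponent
  \<open>2 ^ m\<close> for all functions is \<open>s ^ 3\<close>, so a factor \<open>s\<close> is
  left for the constants. Taking \<open>m\<close> logarithmic in \<open>n\<close> reconciles two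
  demands: time \<open>2 ^ O(m)\<close> has to be polynomial in \<open>n\<close>, and the threshold
  has to exceed a polynomial dictated by the family. Hence \<open>c\<close> is read off the family
  before the distinguisher is built. Since sums are free, circuits are traded for spans in which
  only products are counted, and a machine configuration is described by mutually exclusive
  predicates, so that case distinctions turn into sums. The distinguisher has to be an explicit
  machine. Its parameters are therefore obtained by counting alone: \<open>m\<close> is a constant
  times the length of a binary counter, and the threshold is a power of two. It also has to halt for
  every oracle and every input length, including the small \<open>n\<close> with
  \<open>n < m\<close>; only its advantage, at least 1/2, is restricted to large
  \<open>n\<close>.\<close>

fun comb :: "bool list \<Rightarrow> (bool list \<Rightarrow> bool) list \<Rightarrow> bool list \<Rightarrow> bool" where
  "comb (b # bs) (h # hs) = (\<lambda>x. (b \<and> h x) \<noteq> comb bs hs x)"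
| "comb _ _ = (\<lambda>x. False)"

text \<open>A straight-line program in normal form: a pair holds the coefficient vectors of the two
  factors over everything built from the tail, so the newest product stands at the head. With the
  constant 1 among the generators, the span without products consists of the affine
  functions.\<close>

fun basis :: "nat \<Rightarrow> (bool list \<times> bool list) list \<Rightarrow> (bool list \<Rightarrow> bool) list" where
  "basis n [] = (\<lambda>x. True) # map (\<lambda>i x. x ! i) [0..<n]"
| "basis n ((u, v) # ps) =
     (\<lambda>x. comb u (basis n ps) x \<and> comb v (basis n ps) x) # basis n ps"

text \<open>Since \<open>comb\<close> reads missing coefficients as zero and ignores surplus ones,
  every list is a coefficient vector and the span is a plain range.\<close>

definition and_span :: "nat \<Rightarrow> (bool list \<times> bool list) list \<Rightarrow> (bool list \<Rightarrow> bool) set" where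
  "and_span n ps = range (\<lambda>u. comb u (basis n ps))"

lemma comb_Nil2 [simp]: "comb u [] = (\<lambda>x. False)"
  by (cases u) auto

lemma length_basis [simp]: "length (basis n ps) = Suc n + length ps"
  by (induction n ps rule: basis.induct) auto

lemma comb_xor: "\<exists>w. comb w hs = (\<lambda>x. comb u hs x \<noteq> comb v hs x)"
proof (induction hs arbitrary: u v)
  case Nil
  then show ?case by auto
next
  case (Cons h hs)
  show ?case
  proof (cases u; cases v)
    fix a u' b v' assume uv: "u = a # u'" "v = b # v'"
    obtain w where w: "comb w hs = (\<lambda>x. comb u' hs x \<noteq> comb v' hs x)" using Cons by blast
    show ?thesis
      by (rule exI [of _ "(a \<noteq> b) # w"]) (use uv w in \<open>auto simp: fun_eq_iff\<close>)
  qed (auto intro: exI [of _ u] exI [of _ v])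
qed

lemma comb_member: "h \<in> set hs \<Longrightarrow> \<exists>w. comb w hs = h"
proof (induction hs)
  case (Cons k hs)
  show ?case
  proof (cases "h = k")
    case True
    then show ?thesis by (intro exI [of _ "[True]"]) (auto simp: fun_eq_iff)
  next
    case False
    then obtain w where "comb w hs = h" using Cons by auto
    then show ?thesis by (intro exI [of _ "False # w"]) (auto simp: fun_eq_iff)
  qed
qed auto

lemma and_span_False: "(\<lambda>x. False) \<in> and_span n ps"
  unfolding and_span_def by (intro image_eqI [of _ _ "[]"]) auto

lemma and_span_basis: "h \<in> set (basis n ps) \<Longrightarrow> h \<in> and_span n ps"
  unfolding and_span_def using comb_member by (metis rangeI)

lemma and_span_xor:
  "f \<in> and_span n ps \<Longrightarrow> g \<in> and_span n ps \<Longrightarrow> (\<lambda>x. f x \<noteq> g x) \<in> and_span n ps"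
  unfolding and_span_def using comb_xor by (auto simp: image_iff) metis

lemma and_span_Cons_mono: "and_span n ps \<subseteq> and_span n (p # ps)"
proof
  fix f assume "f \<in> and_span n ps"
  then obtain u where "f = comb u (basis n ps)" by (auto simp: and_span_def)
  then show "f \<in> and_span n (p # ps)" unfolding and_span_def
    by (intro image_eqI [of _ _ "False # u"]) (cases p, auto simp: fun_eq_iff)
qed

lemma and_span_append_mono: "and_span n ps \<subseteq> and_span n (qs @ ps)"
  by (induction qs) (use and_span_Cons_mono in fastforce)+

lemma and_span_True: "(\<lambda>x. True) \<in> and_span n ps"
  using and_span_append_mono [of n "[]" ps] and_span_basis [of "\<lambda>x. True" n "[]"] by auto

lemma and_span_const: "(\<lambda>x. b) \<in> and_span n ps"
  using and_span_True and_span_False by (cases b) auto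

lemma and_span_input: "i < n \<Longrightarrow> (\<lambda>x. x ! i) \<in> and_span n ps"
  using and_span_append_mono [of n "[]" ps] and_span_basis [of "\<lambda>x. x ! i" n "[]"] by auto

lemma and_span_not: "f \<in> and_span n ps \<Longrightarrow> (\<lambda>x. \<not> f x) \<in> and_span n ps"
  using and_span_xor [OF _ and_span_True] by simp

lemma and_span_and:
  assumes "f \<in> and_span n ps" "g \<in> and_span n ps"
  shows "\<exists>p. (\<lambda>x. f x \<and> g x) \<in> and_span n (p # ps)"
proof -
  obtain u v where "f = comb u (basis n ps)" "g = comb v (basis n ps)"
    using assms by (auto simp: and_span_def)
  then have "(\<lambda>x. f x \<and> g x) \<in> and_span n ((u, v) # ps)" by (intro and_span_basis) auto
  then show ?thesis ..
qed

text \<open>An exclusive disjunction is a sum over the field with two elements, hence needs no product.\<close>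

lemma and_span_disjoint_ex:
  assumes "finite I" and "\<And>i. i \<in> I \<Longrightarrow> g i \<in> and_span n ps"
    and "\<And>i j x. i \<in> I \<Longrightarrow> j \<in> I \<Longrightarrow> g i x \<Longrightarrow> g j x \<Longrightarrow> i = j"
  shows "(\<lambda>x. \<exists>i \<in> I. g i x) \<in> and_span n ps"
  using assms
proof (induction I rule: finite_induct)
  case empty
  then show ?case using and_span_False by simp
next
  case (insert j I)
  have "(\<lambda>x. \<exists>i \<in> insert j I. g i x) = (\<lambda>x. g j x \<noteq> (\<exists>i \<in> I. g i x))"
    using insert.hyps insert.prems(2) by (auto simp: fun_eq_iff)
  moreover have "(\<lambda>x. \<exists>i \<in> I. g i x) \<in> and_span n ps"
    by (rule insert.IH) (use insert.prems in auto)
  ultimately show ?case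
    using insert.prems(1) [of j] and_span_xor [of "g j" n ps "\<lambda>x. \<exists>i \<in> I. g i x"] by simp
qed

section \<open>Cost accounting for added products\<close>

text \<open>Functions once obtained stay available, so the costs of successive constructions simply
  add up.\<close>

definition extends_by ::
  "nat \<Rightarrow> (bool list \<times> bool list) list \<Rightarrow> nat \<Rightarrow> (bool list \<times> bool list) list \<Rightarrow> bool" where
  "extends_by n ps k ps' \<longleftrightarrow> length ps' \<le> length ps + k \<and> and_span n ps \<subseteq> and_span n ps'"

lemma extends_by_trans:
  "extends_by n ps k ps' \<Longrightarrow> extends_by n ps' l ps'' \<Longrightarrow> extends_by n ps (k + l) ps''"
  unfolding extends_by_def by auto

lemma extends_by_le: "extends_by n ps k ps' \<Longrightarrow> k \<le> l \<Longrightarrow> extends_by n ps l ps'"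
  unfolding extends_by_def by auto

text \<open>The hypothesis ranges over all extensions \<open>qs\<close> because the products for the
  other indices are already present when an index is treated.\<close>

lemma extends_by_family:
  assumes "finite I"
    and "\<And>i qs. i \<in> I \<Longrightarrow> and_span n ps \<subseteq> and_span n qs \<Longrightarrow>
           \<exists>qs'. extends_by n qs k qs' \<and> g i \<in> and_span n qs'"
  shows "\<exists>ps'. extends_by n ps (k * card I) ps' \<and> (\<forall>i \<in> I. g i \<in> and_span n ps')"
  using assms
proof (induction I rule: finite_induct)
  case empty
  then show ?case by (auto simp: extends_by_def)
next
  case (insert j I)
  obtain ps' where ps': "extends_by n ps (k * card I) ps'" "\<forall>i \<in> I. g i \<in> and_span n ps'"
    using insert.IH insert.prems by blast
  moreover obtain qs where "extends_by n ps' k qs" "g j \<in> and_span n qs"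
    using insert.prems [of j ps'] ps'(1) by (auto simp: extends_by_def)
  ultimately show ?case
    using insert.hyps extends_by_trans [of n ps "k * card I" ps' k qs]
    by (intro exI [of _ qs]) (auto simp: extends_by_def)
qed

lemma extends_by_and_family:
  assumes "finite I"
    and "\<And>i. i \<in> I \<Longrightarrow> f i \<in> and_span n ps" "\<And>i. i \<in> I \<Longrightarrow> g i \<in> and_span n ps"
  shows "\<exists>ps'. extends_by n ps (card I) ps' \<and> (\<forall>i \<in> I. (\<lambda>x. f i x \<and> g i x) \<in> and_span n ps')"
proof -
  have "\<exists>qs'. extends_by n qs 1 qs' \<and> (\<lambda>x. f i x \<and> g i x) \<in> and_span n qs'"
    if i: "i \<in> I" and qs: "and_span n ps \<subseteq> and_span n qs" for i qs
  proof -
    obtain p where "(\<lambda>x. f i x \<and> g i x) \<in> and_span n (p # qs)"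
      using and_span_and [of "f i" n qs "g i"] assms(2,3) [OF i] qs by auto
    then show ?thesis
      using and_span_Cons_mono by (intro exI [of _ "p # qs"]) (auto simp: extends_by_def)
  qed
  from extends_by_family [OF assms(1), of n ps 1, OF this] show ?thesis by auto
qed

lemma extends_by_conj:
  assumes "\<And>f. f \<in> set fs \<Longrightarrow> f \<in> and_span n ps"
  shows "\<exists>ps'. extends_by n ps (length fs) ps' \<and> (\<lambda>x. \<forall>f \<in> set fs. f x) \<in> and_span n ps'"
  using assms
proof (induction fs)
  case Nil
  then show ?case using and_span_True by (auto simp: extends_by_def)
next
  case (Cons f fs)
  obtain ps' where ps': "extends_by n ps (length fs) ps'" "(\<lambda>x. \<forall>f \<in> set fs. f x) \<in> and_span n ps'"
    using Cons by auto
  moreover have "f \<in> and_span n ps'" using Cons.prems ps'(1) by (auto simp: extends_by_def)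
  ultimately obtain p where "(\<lambda>x. f x \<and> (\<forall>f \<in> set fs. f x)) \<in> and_span n (p # ps')"
    using and_span_and by blast
  then show ?case using ps'(1) and_span_Cons_mono
    by (intro exI [of _ "p # ps'"]) (fastforce simp: extends_by_def)
qed

text \<open>A function is the sum of the indicators of the points where it is true, and each
  indicator is a conjunction of \<open>n\<close> affine functions. This guarantees that the minimum
  defining multiplicative complexity is attained.\<close>

lemma all_functions_in_and_span:
  "\<exists>ps. \<exists>h \<in> and_span n ps. \<forall>x \<in> cube n. h x = f x"
proof -
  have fin: "finite {z \<in> cube n. f z}"
    using finite_lists_length_eq [of "UNIV :: bool set" n] by (auto simp: cube_def)
  define g where "g z = (\<lambda>x. \<forall>h \<in> set (map (\<lambda>i x. x ! i = z ! i) [0..<n]). h x)"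
    for z :: "bool list"
  have g: "g z x \<longleftrightarrow> (\<forall>i<n. x ! i = z ! i)" for z x by (auto simp: g_def)
  have "\<exists>qs'. extends_by n qs n qs' \<and> g z \<in> and_span n qs'" for z qs
  proof -
    have "h \<in> and_span n qs" if h: "h \<in> set (map (\<lambda>i x. x ! i = z ! i) [0..<n])" for h
    proof -
      obtain i where i: "i < n" "h = (\<lambda>x. x ! i = z ! i)" using h by auto
      \<comment> \<open>Equality with a fixed bit is the sum of the variable and the negated bit,
        hence affine.\<close>
      have "(\<lambda>x. x ! i \<noteq> (\<not> z ! i)) \<in> and_span n qs"
        by (rule and_span_xor [OF and_span_input [OF i(1)] and_span_const])
      then show ?thesis using i(2) by simp
    qed
    from extends_by_conj [of "map (\<lambda>i x. x ! i = z ! i) [0..<n]" n qs, OF this]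
    show ?thesis by (simp add: g_def)
  qed
  with extends_by_family [of "{z \<in> cube n. f z}" n "[]" n g] fin
  obtain ps where ps: "\<forall>z \<in> {z \<in> cube n. f z}. g z \<in> and_span n ps" by blast
  have "(\<lambda>x. \<exists>z \<in> {z \<in> cube n. f z}. g z x) \<in> and_span n ps"
  proof (rule and_span_disjoint_ex [OF fin])
    fix y z x assume "y \<in> {z \<in> cube n. f z}" "z \<in> {z \<in> cube n. f z}" "g y x" "g z x"
    then show "y = z" by (auto simp: g cube_def intro: nth_equalityI)
  qed (use ps in auto)
  moreover have "(\<exists>z \<in> {z \<in> cube n. f z}. g z x) = f x" if "x \<in> cube n" for x
  proof -
    have "g z x \<longleftrightarrow> z = x" if "z \<in> cube n" for z
      using that \<open>x \<in> cube n\<close> by (auto simp: g cube_def intro: nth_equalityI)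
    then show ?thesis using that by blast
  qed
  ultimately show ?thesis
    by (intro exI [of _ ps] bexI [of _ "\<lambda>x. \<exists>z \<in> {z \<in> cube n. f z}. g z x"] ballI)
qed


section \<open>Circuits and spans\<close>

definition wires :: "gate list \<Rightarrow> bool list \<Rightarrow> bool list" where
  "wires gs x = foldl (\<lambda>vs g. vs @ [gate_val vs g]) x gs"

lemma circuit_val_wires: "circuit_val C x = wires (fst C) x ! snd C"
  by (simp add: circuit_val_def wires_def)

lemma wires_simps [simp]:
  "wires [] x = x" "wires (gs @ [g]) x = wires gs x @ [gate_val (wires gs x) g]"
  by (simp_all add: wires_def)

lemma length_wires [simp]: "length (wires gs x) = length x + length gs"
  by (induction gs rule: rev_induct) auto

definition gates_wf :: "nat \<Rightarrow> gate list \<Rightarrow> bool" where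
  "gates_wf n gs \<longleftrightarrow> (\<forall>i < length gs. gate_wf (n + i) (gs ! i))"

lemma gates_wf_snoc: "gates_wf n (gs @ [g]) \<longleftrightarrow> gates_wf n gs \<and> gate_wf (n + length gs) g"
  by (auto simp: gates_wf_def nth_append less_Suc_eq)

lemma circuit_wf_gates: "circuit_wf n C \<longleftrightarrow> gates_wf n (fst C) \<and> snd C < n + length (fst C)"
  by (simp add: circuit_wf_def gates_wf_def)

definition and_gates :: "gate list \<Rightarrow> nat" where
  "and_gates gs = length (filter (\<lambda>g. \<exists>i j. g = AndG i j) gs)"

lemma and_gates_simps [simp]:
  "and_gates [] = 0" "and_gates (gs @ [AndG i j]) = Suc (and_gates gs)"
  "and_gates (gs @ [XorG i j]) = and_gates gs" "and_gates (gs @ [OneG]) = and_gates gs"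
  by (auto simp: and_gates_def)

text \<open>Agreement is demanded on the cube only, as an input of another length would shift the
  numbers of the gate wires.\<close>

definition on_wire :: "nat \<Rightarrow> gate list \<Rightarrow> (bool list \<Rightarrow> bool) \<Rightarrow> nat \<Rightarrow> bool" where
  "on_wire n gs f w \<longleftrightarrow> w < n + length gs \<and> (\<forall>x \<in> cube n. wires gs x ! w = f x)"

text \<open>Gate by gate, every wire carries a member of the span; only an \<open>AndG\<close>
  forces a new entry of the product list, the other gates stay within the span.\<close>

lemma wires_in_and_span:
  assumes "gates_wf n gs"
  shows "\<exists>ps. length ps = and_gates gs \<and> (\<forall>w < n + length gs. \<exists>h \<in> and_span n ps. on_wire n gs h w)"
  using assms
proof (induction gs rule: rev_induct)
  case Nil
  then show ?case by (auto simp: on_wire_def cube_def intro!: bexI [OF _ and_span_input])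
next
  case (snoc g gs)
  then obtain ps where ps: "length ps = and_gates gs"
    "\<And>w. w < n + length gs \<Longrightarrow> \<exists>h \<in> and_span n ps. on_wire n gs h w"
    by (auto simp: gates_wf_snoc)
  have wf: "gate_wf (n + length gs) g" using snoc.prems by (simp add: gates_wf_snoc)
  have old: "\<exists>h \<in> and_span n qs. on_wire n (gs @ [g]) h w"
    if "w < n + length gs" "and_span n ps \<subseteq> and_span n qs" for w qs
  proof -
    obtain h where h: "h \<in> and_span n ps" "on_wire n gs h w" using ps(2) \<open>w < _\<close> by blast
    then have "on_wire n (gs @ [g]) h w" by (auto simp: on_wire_def nth_append cube_def)
    then show ?thesis using that h by blast
  qed
  have "\<exists>qs. length qs = and_gates (gs @ [g]) \<and> and_span n ps \<subseteq> and_span n qs \<and>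
          (\<exists>h \<in> and_span n qs. \<forall>x \<in> cube n. gate_val (wires gs x) g = h x)"
  proof (cases g)
    case (AndG i j)
    obtain f h where "f \<in> and_span n ps" "on_wire n gs f i" "h \<in> and_span n ps" "on_wire n gs h j"
      using ps(2) wf AndG by (meson gate_wf.simps(1))
    moreover obtain p where "(\<lambda>x. f x \<and> h x) \<in> and_span n (p # ps)"
      using and_span_and calculation by blast
    ultimately show ?thesis using AndG ps(1) and_span_Cons_mono
      by (intro exI [of _ "p # ps"]) (auto simp: on_wire_def intro!: bexI [of _ "\<lambda>x. f x \<and> h x"])
  next
    case (XorG i j)
    obtain f h where "f \<in> and_span n ps" "on_wire n gs f i" "h \<in> and_span n ps" "on_wire n gs h j"
      using ps(2) wf XorG by (meson gate_wf.simps(2))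
    then show ?thesis using XorG ps(1) and_span_xor
      by (intro exI [of _ ps]) (auto simp: on_wire_def intro!: bexI [of _ "\<lambda>x. f x \<noteq> h x"])
  next
    case OneG
    then show ?thesis using ps(1) and_span_True
      by (intro exI [of _ ps]) (auto intro!: bexI [of _ "\<lambda>x. True"])
  qed
  then obtain qs h where qs: "length qs = and_gates (gs @ [g])" "and_span n ps \<subseteq> and_span n qs"
    "h \<in> and_span n qs" "\<forall>x \<in> cube n. gate_val (wires gs x) g = h x" by blast
  have "\<exists>h \<in> and_span n qs. on_wire n (gs @ [g]) h w" if "w < n + length (gs @ [g])" for w
  proof (cases "w < n + length gs")
    case True
    then show ?thesis using old qs(2) by blast
  next
    case False
    then have "w = n + length gs" using that by simp
    then have "on_wire n (gs @ [g]) h w"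
      using qs(4) by (auto simp: on_wire_def nth_append cube_def)
    then show ?thesis using qs(3) by blast
  qed
  then show ?case using qs(1) by blast
qed

section \<open>From spans back to circuits\<close>

text \<open>Growth that is free of charge: no AND gate is added, and each old function remains on
  its old wire, so wire numbers found earlier stay valid.\<close>

definition xor_extends :: "nat \<Rightarrow> gate list \<Rightarrow> gate list \<Rightarrow> bool" where
  "xor_extends n gs gs' \<longleftrightarrow>
     gates_wf n gs' \<and> and_gates gs' = and_gates gs \<and> (\<forall>f w. on_wire n gs f w \<longrightarrow> on_wire n gs' f w)"

lemma on_wire_snoc: "on_wire n gs f w \<Longrightarrow> on_wire n (gs @ [g]) f w"
  by (auto simp: on_wire_def nth_append cube_def)

lemma on_wire_last:
  "(\<And>x. x \<in> cube n \<Longrightarrow> gate_val (wires gs x) g = f x) \<Longrightarrow> on_wire n (gs @ [g]) f (n + length gs)"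
  by (auto simp: on_wire_def nth_append cube_def)

lemma xor_extends_comb:
  assumes "gates_wf n gs" and "\<And>h. h \<in> set hs \<Longrightarrow> \<exists>w. on_wire n gs h w"
  shows "\<exists>gs' w. xor_extends n gs gs' \<and> on_wire n gs' (comb u hs) w"
  using assms(2)
proof (induction u hs rule: comb.induct)
  case (1 b bs h hs)
  then obtain gs' w where gs': "xor_extends n gs gs'" "on_wire n gs' (comb bs hs) w" by auto
  obtain v where v: "on_wire n gs' h v"
    using "1.prems" [of h] gs'(1) by (fastforce simp: xor_extends_def)
  show ?case
  proof (cases b)
    case True
    have "xor_extends n gs (gs' @ [XorG v w])"
      using gs' v by (auto simp: xor_extends_def gates_wf_snoc on_wire_snoc)
        (auto simp: on_wire_def)
    moreover have "on_wire n (gs' @ [XorG v w]) (comb (b # bs) (h # hs)) (n + length gs')"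
      using True gs'(2) v by (intro on_wire_last) (auto simp: on_wire_def)
    ultimately show ?thesis by blast
  next
    case False
    then show ?thesis using gs' by auto
  qed
next
  have *: "\<exists>gs' w. xor_extends n gs gs' \<and> on_wire n gs' (\<lambda>x. False) w"
  proof -
    \<comment> \<open>There is no gate for the constant 0; it is produced as 1 + 1.\<close>
    let ?w = "n + length gs"
    let ?gs = "(gs @ [OneG]) @ [XorG ?w ?w]"
    have "xor_extends n gs ?gs"
      unfolding xor_extends_def using assms(1)
      by (intro conjI allI impI on_wire_snoc) (simp_all add: gates_wf_snoc del: append_assoc)
    moreover have "on_wire n ?gs (\<lambda>x. False) (n + length (gs @ [OneG]))"
      by (rule on_wire_last) auto
    ultimately show ?thesis by blast
  qed
  case ("2_1" hs)
  show ?case using * by simp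
  case ("2_2" u)
  show ?case using * by simp
qed

text \<open>Both factors of a pair are combinations of available wires and cost XOR gates and
  \<open>OneG\<close> gates only, so each pair accounts for exactly one AND gate.\<close>

lemma basis_on_wires:
  "\<exists>gs. gates_wf n gs \<and> and_gates gs = length ps \<and> (\<forall>h \<in> set (basis n ps). \<exists>w. on_wire n gs h w)"
proof (induction n ps rule: basis.induct)
  case (1 n)
  have "on_wire n ([] @ [OneG]) (\<lambda>x. True) (n + length ([] :: gate list))"
    by (rule on_wire_last) auto
  moreover have "on_wire n ([] @ [OneG]) (\<lambda>x. x ! i) i" if "i < n" for i
    by (rule on_wire_snoc) (use that in \<open>auto simp: on_wire_def\<close>)
  ultimately show ?case
    by (intro exI [of _ "[] @ [OneG]"]) (force simp: gates_wf_def and_gates_def)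
next
  case (2 n u v ps)
  then obtain gs where gs: "gates_wf n gs" "and_gates gs = length ps"
    "\<And>h. h \<in> set (basis n ps) \<Longrightarrow> \<exists>w. on_wire n gs h w" by blast
  obtain gs1 i where gs1: "xor_extends n gs gs1" "on_wire n gs1 (comb u (basis n ps)) i"
    using xor_extends_comb [OF gs(1,3)] by blast
  have "\<And>h. h \<in> set (basis n ps) \<Longrightarrow> \<exists>w. on_wire n gs1 h w" "gates_wf n gs1"
    using gs1(1) gs(3) unfolding xor_extends_def by blast+
  then obtain gs2 j where gs2: "xor_extends n gs1 gs2" "on_wire n gs2 (comb v (basis n ps)) j"
    using xor_extends_comb by blast
  have i: "on_wire n gs2 (comb u (basis n ps)) i" using gs1 gs2 by (auto simp: xor_extends_def)
  let ?gs = "gs2 @ [AndG i j]"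
  have "on_wire n ?gs (\<lambda>x. comb u (basis n ps) x \<and> comb v (basis n ps) x) (n + length gs2)"
    using i gs2(2) by (intro on_wire_last) (auto simp: on_wire_def)
  moreover have "\<exists>w. on_wire n ?gs h w" if "h \<in> set (basis n ps)" for h
    using gs(3) [OF that] gs1(1) gs2(1) on_wire_snoc unfolding xor_extends_def by blast
  moreover have "gates_wf n ?gs" "and_gates ?gs = length ((u, v) # ps)"
    using i gs2 gs1(1) gs(2) by (auto simp: xor_extends_def gates_wf_snoc on_wire_def)
  ultimately show ?case by (intro exI [of _ ?gs]) auto
qed

lemma and_span_circuit:
  assumes "h \<in> and_span n ps" and "\<And>x. x \<in> cube n \<Longrightarrow> h x = f x"
  shows "\<exists>C. computes n C f \<and> and_count C = length ps"
proof -
  obtain u where u: "h = comb u (basis n ps)" using assms(1) by (auto simp: and_span_def)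
  obtain gs where gs: "gates_wf n gs" "and_gates gs = length ps"
    "\<And>h. h \<in> set (basis n ps) \<Longrightarrow> \<exists>w. on_wire n gs h w"
    using basis_on_wires by blast
  obtain gs' w where "xor_extends n gs gs'" "on_wire n gs' h w"
    using xor_extends_comb [OF gs(1,3)] u by blast
  then show ?thesis using gs(2) assms(2)
    by (intro exI [of _ "(gs', w)"])
      (auto simp: computes_def circuit_wf_gates xor_extends_def on_wire_def circuit_val_wires
        and_count_def and_gates_def)
qed

lemma mult_complexity_le:
  "h \<in> and_span n ps \<Longrightarrow> (\<And>x. x \<in> cube n \<Longrightarrow> h x = f x) \<Longrightarrow> mult_complexity n f \<le> length ps"
  unfolding mult_complexity_def using and_span_circuit by (blast intro: Least_le)

text \<open>Together with \<open>mult_complexity_le\<close> this identifies multiplicative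
  complexity with the least length of a product list; the counting and the simulation below work
  with spans only.\<close>

lemma mult_complexity_and_span:
  "\<exists>ps. length ps = mult_complexity n f \<and> (\<exists>h \<in> and_span n ps. \<forall>x \<in> cube n. h x = f x)"
proof -
  have "\<exists>a C. computes n C f \<and> and_count C = a"
    using all_functions_in_and_span [of n f] and_span_circuit by blast
  then obtain C where C: "computes n C f" "and_count C = mult_complexity n f"
    unfolding mult_complexity_def using LeastI_ex [of "\<lambda>a. \<exists>C. computes n C f \<and> and_count C = a"]
    by blast
  then obtain ps h where "length ps = and_gates (fst C)"
    "h \<in> and_span n ps" "on_wire n (fst C) h (snd C)"
    using wires_in_and_span [of n "fst C"] by (auto simp: computes_def circuit_wf_gates)
  then show ?thesis using C
    by (intro exI [of _ ps] conjI bexI [of _ h])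
      (auto simp: computes_def on_wire_def circuit_val_wires and_gates_def and_count_def)
qed


section \<open>Counting functions of small multiplicative complexity\<close>

text \<open>Coefficient lists of any length occur in a span; cutting or zero-padding them to a
  common length makes the descriptions a finite set that can be counted.\<close>

definition resize :: "nat \<Rightarrow> bool list \<Rightarrow> bool list" where
  "resize k u = take k (u @ replicate k False)"

lemma length_resize [simp]: "length (resize k u) = k"
  by (simp add: resize_def)

lemma comb_resize: "length hs \<le> k \<Longrightarrow> comb (resize k u) hs = comb u hs"
proof (induction u hs arbitrary: k rule: comb.induct)
  case (1 b bs h hs)
  obtain l where l: "k = Suc l" using 1 by (cases k) auto
  then have "resize k (b # bs) = b # resize l bs"
    by (simp add: resize_def min_def del: replicate_Suc)
  then show ?case using 1 l by simp
next
  case ("2_1" hs)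
  have "comb (replicate k False) hs = (\<lambda>x. False)" for k
    by (induction hs arbitrary: k) (case_tac k; auto)+
  then show ?case by (simp add: resize_def)
qed auto

lemma basis_resize:
  "Suc n + length ps \<le> k \<Longrightarrow> basis n (map (map_prod (resize k) (resize k)) ps) = basis n ps"
  by (induction n ps rule: basis.induct) (auto simp: comb_resize)

text \<open>A description consists of two coefficient vectors per product and one for the output,
  that is \<open>2 * s + 1\<close> vectors, all of the length \<open>Suc n + s\<close> of the full
  basis.\<close>

lemma card_mult_complexity_le:
  "card {f \<in> bool_funs n. mult_complexity n f \<le> s} \<le> 2 ^ ((2 * s + 1) * (Suc n + s))"
proof -
  define k where "k = Suc n + s"
  define U :: "bool list set" where "U = {u. length u = k}"
  define P where "P = {ps. set ps \<subseteq> U \<times> U \<and> length ps = s}"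
  have finU: "finite U" and cardU: "card U = 2 ^ k"
    using finite_lists_length_eq [of "UNIV :: bool set" k] card_lists_length_eq [of "UNIV :: bool set" k]
    by (auto simp: U_def)
  have finP: "finite P" and cardP: "card P = (2 ^ k * 2 ^ k) ^ s"
    unfolding P_def
        using finite_lists_length_eq [of "U \<times> U" s] card_lists_length_eq [of "U \<times> U" s] finU
    by (auto simp: card_cartesian_product cardU)
  have "{f \<in> bool_funs n. mult_complexity n f \<le> s} \<subseteq>
      (\<lambda>(u, ps). restrict (comb u (basis n ps)) (cube n)) ` (U \<times> P)"
  proof
    fix f assume f: "f \<in> {f \<in> bool_funs n. mult_complexity n f \<le> s}"
    obtain ps h where ps: "length ps = mult_complexity n f" "h \<in> and_span n ps"
      "\<forall>x \<in> cube n. h x = f x" using mult_complexity_and_span by blast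
    \<comment> \<open>Shorter lists are filled up to \<open>s\<close> with products of two empty
      combinations, which are zero and only enlarge the span.\<close>
    define qs where "qs = replicate (s - length ps) ([], []) @ ps"
    have qs: "length qs = s" using f ps(1) by (simp add: qs_def)
    have "h \<in> and_span n qs" using and_span_append_mono ps(2) unfolding qs_def by blast
    then obtain u where u: "h = comb u (basis n qs)" by (auto simp: and_span_def)
    define rs where "rs = map (map_prod (resize k) (resize k)) qs"
    have "h = comb (resize k u) (basis n rs)"
      unfolding rs_def u using qs by (simp add: basis_resize comb_resize k_def)
    moreover have "f = restrict h (cube n)"
      using f ps(3) by (auto simp: bool_funs_def fun_eq_iff restrict_def PiE_def extensional_def)
    moreover have "(resize k u, rs) \<in> U \<times> P" by (auto simp: U_def P_def rs_def qs)
    ultimately show "f \<in> (\<lambda>(u, ps). restrict (comb u (basis n ps)) (cube n)) ` (U \<times> P)" by force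
  qed
  then have "card {f \<in> bool_funs n. mult_complexity n f \<le> s} \<le> card (U \<times> P)"
    using finU finP by (meson card_image_le card_mono finite_SigmaI finite_imageI order_trans)
  also have "\<dots> = 2 ^ ((2 * s + 1) * k)"
    by (simp add: card_cartesian_product cardU cardP power_mult [symmetric] power_add [symmetric]
        algebra_simps)
  finally show ?thesis by (simp add: k_def)
qed


section \<open>Multiplicative complexity of functions computed by Turing machines\<close>

definition reads :: "config \<Rightarrow> nat list" where
  "reads c = map (\<lambda>tp. fst tp (snd tp)) (snd c)"

text \<open>Halting states become self-loops that rewrite what they read, so every step, halted or
  not, is one application of a transition function and needs no case distinction when it is
  simulated.\<close>

definition total_delta :: "tm \<Rightarrow> transition" where
  "total_delta M q rs =
     (if q = accept_state \<or> q = reject_state then (q, map (\<lambda>r. (r, Stay)) rs) else delta M q rs)"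

definition config_ok :: "tm \<Rightarrow> config \<Rightarrow> bool" where
  "config_ok M c \<longleftrightarrow> fst c < nstates M \<and> length (snd c) = ntapes M \<and>
     (\<forall>i < ntapes M. \<forall>p. fst (snd c ! i) p < nsyms M)"

lemma act_Stay [simp]: "act (fst tp (snd tp), Stay) tp = tp"
  by (simp add: act_def)

lemma tm_step_total: "tm_step M c = apply_transition (total_delta M) c"
proof -
  have "map2 act (map (\<lambda>r. (r, Stay)) (map (\<lambda>tp. fst tp (snd tp)) tps)) tps = tps"
      for tps :: "tape list"
    by (rule nth_equalityI) auto
  then show ?thesis
    by (cases c) (auto simp: tm_step_def apply_transition_def total_delta_def halted_def)
qed

lemma total_delta_wf:
  assumes "tm_wf M"
  shows "transition_wf (ntapes M) (nstates M) (nsyms M) (total_delta M)"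
  using assms unfolding tm_wf_def transition_wf_def total_delta_def by force

lemma config_ok_reads:
  assumes "config_ok M c"
  shows "length (reads c) = ntapes M" "set (reads c) \<subseteq> {..<nsyms M}"
    "i < ntapes M \<Longrightarrow> reads c ! i = fst (snd c ! i) (snd (snd c ! i))"
  using assms by (auto simp: config_ok_def reads_def in_set_conv_nth) (metis fst_conv)

lemma tm_step_config:
  assumes "tm_wf M" "config_ok M c"
  shows "fst (tm_step M c) = fst (total_delta M (fst c) (reads c))"
    and "length (snd (tm_step M c)) = ntapes M"
    and "i < ntapes M \<Longrightarrow>
      snd (tm_step M c) ! i = act (snd (total_delta M (fst c) (reads c)) ! i) (snd c ! i)"
proof -
  have "length (snd (total_delta M (fst c) (reads c))) = ntapes M"
    using total_delta_wf [OF assms(1)] assms(2) config_ok_reads [OF assms(2)]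
    by (auto simp: transition_wf_def config_ok_def)
  then show "fst (tm_step M c) = fst (total_delta M (fst c) (reads c))"
    "length (snd (tm_step M c)) = ntapes M"
    "i < ntapes M \<Longrightarrow>
      snd (tm_step M c) ! i = act (snd (total_delta M (fst c) (reads c)) ! i) (snd c ! i)"
    using assms(2)
    by (auto simp: tm_step_total apply_transition_def reads_def config_ok_def split: prod.splits)
qed

lemma total_delta_bounds:
  assumes "tm_wf M" "config_ok M c" "i < ntapes M"
  shows "fst (snd (total_delta M (fst c) (reads c)) ! i) < nsyms M"
  using total_delta_wf [OF assms(1)] config_ok_reads [OF assms(2)] assms(2,3)
  by (force simp: transition_wf_def config_ok_def)

lemma config_ok_step: "tm_wf M \<Longrightarrow> config_ok M c \<Longrightarrow> config_ok M (tm_step M c)"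
  using total_delta_bounds [of M c] tm_step_config [of M c] total_delta_wf [of M]
    config_ok_reads [of M c]
  by (auto simp: config_ok_def act_def transition_wf_def)

text \<open>A one-hot encoding: each possible state, cell content and head position has its own
  predicate on inputs. For fixed input, competing predicates exclude each other, which lets reading
  and updating be expressed by sums.\<close>

definition tracked :: "nat \<Rightarrow> nat \<Rightarrow> (bool list \<times> bool list) list \<Rightarrow> (bool list \<Rightarrow> config) \<Rightarrow> bool" where
  "tracked K n ps c \<longleftrightarrow>
     (\<forall>q. (\<lambda>x. fst (c x) = q) \<in> and_span n ps) \<and>
     (\<forall>i < K. \<forall>p a. (\<lambda>x. fst (snd (c x) ! i) p = a) \<in> and_span n ps) \<and>
     (\<forall>i < K. \<forall>p. (\<lambda>x. snd (snd (c x) ! i) = p) \<in> and_span n ps)"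

text \<open>The cost of a step per head position: two batches pairing a position with a symbol,
  \<open>Suc (ntapes M)\<close> products for each combination of a state with read symbols, and one
  batch pairing the three moves with a position.\<close>

definition step_cost :: "tm \<Rightarrow> nat" where
  "step_cost M = 2 * (ntapes M * nsyms M) + Suc (ntapes M) * (nstates M * nsyms M ^ ntapes M) +
     3 * ntapes M"

text \<open>Products are spent in four batches: finding the symbols under the heads, combining state
  and symbols, moving the heads, and writing. Heads lie between \<open>- T\<close> and
  \<open>T\<close>, so \<open>2 * T + 1\<close> positions suffice; everything else is a sum of
  exclusive cases.\<close>

lemma tracked_step:
  assumes wf: "tm_wf M" and ok: "\<And>x. config_ok M (c x)"
    and head: "\<And>x i. i < ntapes M \<Longrightarrow> \<bar>snd (snd (c x) ! i)\<bar> \<le> int T"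
    and tr: "tracked (ntapes M) n ps c"
  shows "\<exists>ps'. extends_by n ps (step_cost M * (2 * T + 1)) ps' \<and>
           tracked (ntapes M) n ps' (\<lambda>x. tm_step M (c x))"
proof -
  define K Q G where "K = ntapes M" and "Q = nstates M" and "G = nsyms M"
  define P where "P = {- int T..int T}"
  define D :: "int set" where "D = {-1, 0, 1}"
  have P: "finite P" "card P = 2 * T + 1" by (auto simp: P_def)
  have headP: "snd (snd (c x) ! i) \<in> P" if "i < K" for x i
    using head [of i x] that by (auto simp: P_def K_def abs_le_iff)
  have st: "(\<lambda>x. fst (c x) = q) \<in> and_span n ps" for q
    using tr by (simp add: tracked_def)
  have ce: "(\<lambda>x. fst (snd (c x) ! i) p = a) \<in> and_span n ps" if "i < K" for i p a
    using tr that by (simp add: tracked_def K_def)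
  have he: "(\<lambda>x. snd (snd (c x) ! i) = p) \<in> and_span n ps" if "i < K" for i p
    using tr that by (simp add: tracked_def K_def)
  have cell_less: "fst (snd (c x) ! i) p < G" if "i < K" for x i p
    using ok that by (simp add: config_ok_def K_def G_def)

  define I1 where "I1 = {..<K} \<times> P \<times> {..<G}"
  have "\<exists>ps'. extends_by n ps (card I1) ps' \<and>
      (\<forall>j \<in> I1. (\<lambda>x. snd (snd (c x) ! fst j) = fst (snd j) \<and>
         fst (snd (c x) ! fst j) (fst (snd j)) = snd (snd j)) \<in> and_span n ps')"
    by (rule extends_by_and_family) (auto simp: I1_def P intro: ce he)
  then obtain ps1 where ext1: "extends_by n ps (card I1) ps1" and ps1:
    "\<And>i p a. i < K \<Longrightarrow> p \<in> P \<Longrightarrow> a < G \<Longrightarrow>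
       (\<lambda>x. snd (snd (c x) ! i) = p \<and> fst (snd (c x) ! i) p = a) \<in> and_span n ps1"
    by (force simp: I1_def)
  have rd: "(\<lambda>x. reads (c x) ! i = a) \<in> and_span n ps1" if i: "i < K" for i a
  proof (cases "a < G")
    case True
    have "(\<lambda>x. \<exists>p \<in> P. snd (snd (c x) ! i) = p \<and> fst (snd (c x) ! i) p = a) \<in> and_span n ps1"
      by (rule and_span_disjoint_ex) (use P ps1 i True in auto)
    moreover have "(\<lambda>x. reads (c x) ! i = a) =
        (\<lambda>x. \<exists>p \<in> P. snd (snd (c x) ! i) = p \<and> fst (snd (c x) ! i) p = a)"
      using headP [OF i] config_ok_reads(3) [OF ok] i by (auto simp: fun_eq_iff K_def)
    ultimately show ?thesis by simp
  next
    case False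
    then have "(\<lambda>x. reads (c x) ! i = a) = (\<lambda>x. False)"
      using cell_less [OF i] config_ok_reads(3) [OF ok] i by (auto simp: fun_eq_iff K_def)
    then show ?thesis using and_span_False by simp
  qed

  define R where "R = {..<Q} \<times> {rs. set rs \<subseteq> {..<G} \<and> length rs = K}"
  have R: "finite R" "card R = Q * G ^ K"
    using finite_lists_length_eq [of "{..<G}" K] card_lists_length_eq [of "{..<G}" K]
    by (auto simp: R_def card_cartesian_product)
  have inR: "(fst (c x), reads (c x)) \<in> R" for x
    using ok [of x] config_ok_reads [OF ok] by (auto simp: R_def config_ok_def K_def Q_def G_def)
  have "\<exists>ps'. extends_by n ps1 (Suc K * card R) ps' \<and>
      (\<forall>j \<in> R. (\<lambda>x. (fst (c x), reads (c x)) = j) \<in> and_span n ps')"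
  proof (rule extends_by_family [OF R(1)])
    fix j qs assume j: "j \<in> R" and qs: "and_span n ps1 \<subseteq> and_span n qs"
    define fs where
      "fs = (\<lambda>x. fst (c x) = fst j) # map (\<lambda>i x. reads (c x) ! i = snd j ! i) [0..<K]"
    have "f \<in> and_span n qs" if "f \<in> set fs" for f
      using that st [of "fst j"] ext1 rd qs by (auto simp: fs_def extends_by_def)
    then have "\<exists>qs'. extends_by n qs (length fs) qs' \<and> (\<lambda>x. \<forall>f \<in> set fs. f x) \<in> and_span n qs'"
      by (rule extends_by_conj)
    moreover have "(\<forall>f \<in> set fs. f x) \<longleftrightarrow> (fst (c x), reads (c x)) = j" for x
      using j config_ok_reads(1) [OF ok [of x]]
      by (cases j) (auto simp: fs_def R_def K_def intro: nth_equalityI)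
    ultimately show "\<exists>qs'. extends_by n qs (Suc K) qs' \<and>
        (\<lambda>x. (fst (c x), reads (c x)) = j) \<in> and_span n qs'"
      by (simp add: fs_def)
  qed
  then obtain ps2 where ext2: "extends_by n ps1 (Suc K * card R) ps2"
    and ps2: "\<forall>j \<in> R. (\<lambda>x. (fst (c x), reads (c x)) = j) \<in> and_span n ps2" by blast
  \<comment> \<open>Any predicate of the state and the read symbols is a sum of the indicators in
    \<open>R\<close>. The next state, the written symbols and the moves therefore need no further
    product.\<close>
  have ctl: "(\<lambda>x. \<Phi> (fst (c x)) (reads (c x))) \<in> and_span n ps2" for \<Phi>
  proof -
    have "(\<lambda>x. \<exists>j \<in> {j \<in> R. \<Phi> (fst j) (snd j)}. (fst (c x), reads (c x)) = j) \<in> and_span n ps2"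
      by (rule and_span_disjoint_ex) (use R ps2 in auto)
    moreover have "(\<lambda>x. \<exists>j \<in> {j \<in> R. \<Phi> (fst j) (snd j)}. (fst (c x), reads (c x)) = j) =
        (\<lambda>x. \<Phi> (fst (c x)) (reads (c x)))"
      using inR by (auto simp: fun_eq_iff)
    ultimately show ?thesis by simp
  qed
  define ac where "ac i x = snd (total_delta M (fst (c x)) (reads (c x))) ! i" for i x
  have mv: "(\<lambda>x. move_offset (snd (ac i x)) = d) \<in> and_span n ps2" for i d
    unfolding ac_def by (rule ctl [of "\<lambda>q rs. move_offset (snd (snd (total_delta M q rs) ! i)) =
        d"])
  have wr: "(\<lambda>x. fst (ac i x) = a) \<in> and_span n ps2" for i a
    unfolding ac_def by (rule ctl [of "\<lambda>q rs. fst (snd (total_delta M q rs) ! i) = a"])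
  have sub2: "and_span n ps \<subseteq> and_span n ps2" "and_span n ps1 \<subseteq> and_span n ps2"
    using ext1 ext2 by (auto simp: extends_by_def)

  define I3 where "I3 = {..<K} \<times> D \<times> P"
  have "\<exists>ps'. extends_by n ps2 (card I3) ps' \<and>
      (\<forall>j \<in> I3. (\<lambda>x. move_offset (snd (ac (fst j) x)) = fst (snd j) \<and>
         snd (snd (c x) ! fst j) = snd (snd j)) \<in> and_span n ps')"
    by (rule extends_by_and_family) (use sub2 mv he P in \<open>auto simp: I3_def D_def\<close>)
  then obtain ps3 where ext3: "extends_by n ps2 (card I3) ps3" and ps3:
    "\<And>i d p. i < K \<Longrightarrow> d \<in> D \<Longrightarrow> p \<in> P \<Longrightarrow>
       (\<lambda>x. move_offset (snd (ac i x)) = d \<and> snd (snd (c x) ! i) = p) \<in> and_span n ps3"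
    by (force simp: I3_def)

  define I4 where "I4 = {..<K} \<times> P \<times> {..<G}"
  have sub3: "and_span n ps \<subseteq> and_span n ps3" "and_span n ps1 \<subseteq> and_span n ps3"
    "and_span n ps2 \<subseteq> and_span n ps3"
    using sub2 ext3 by (auto simp: extends_by_def)
  have "\<exists>ps'. extends_by n ps3 (card I4) ps' \<and>
      (\<forall>j \<in> I4. (\<lambda>x. snd (snd (c x) ! fst j) = fst (snd j) \<and>
         fst (ac (fst j) x) = snd (snd j)) \<in> and_span n ps')"
    by (rule extends_by_and_family) (use sub3 wr he P in \<open>auto simp: I4_def\<close>)
  then obtain ps4 where ext4: "extends_by n ps3 (card I4) ps4" and ps4:
    "\<And>i p a. i < K \<Longrightarrow> p \<in> P \<Longrightarrow> a < G \<Longrightarrow>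
       (\<lambda>x. snd (snd (c x) ! i) = p \<and> fst (ac i x) = a) \<in> and_span n ps4"
    by (force simp: I4_def)
  have sub4: "and_span n ps \<subseteq> and_span n ps4" "and_span n ps1 \<subseteq> and_span n ps4"
    "and_span n ps2 \<subseteq> and_span n ps4" "and_span n ps3 \<subseteq> and_span n ps4"
    using sub3 ext4 by (auto simp: extends_by_def)

  have step: "snd (tm_step M (c x)) ! i = act (ac i x) (snd (c x) ! i)" if "i < K" for i x
    using tm_step_config(3) [OF wf ok] that by (simp add: ac_def K_def)
  have ac_less: "fst (ac i x) < G" if "i < K" for i x
    using total_delta_bounds [OF wf ok] that by (simp add: ac_def K_def G_def)

  have new_state: "(\<lambda>x. fst (tm_step M (c x)) = q) \<in> and_span n ps4" for q
    using ctl [of "\<lambda>q' rs. fst (total_delta M q' rs) = q"] sub4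
    by (auto simp: tm_step_config(1) [OF wf ok])
  have new_head: "(\<lambda>x. snd (snd (tm_step M (c x)) ! i) = p) \<in> and_span n ps4" if i: "i < K" for i p
  proof -
    \<comment> \<open>The head arrives at \<open>p\<close> by move \<open>d\<close> exactly when it
      was at \<open>p - d\<close>; positions outside \<open>P\<close> contribute the zero
      function.\<close>
    have "(\<lambda>x. move_offset (snd (ac i x)) = d \<and> snd (snd (c x) ! i) = p - d) \<in> and_span n ps4"
      if "d \<in> D" for d
    proof (cases "p - d \<in> P")
      case True
      then show ?thesis using ps3 [OF i that] sub4 by blast
    next
      case False
      then have "(\<lambda>x. move_offset (snd (ac i x)) = d \<and> snd (snd (c x) ! i) = p - d) = (\<lambda>x. False)"
        using headP [OF i] by (metis (no_types))
      then show ?thesis using and_span_False by simp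
    qed
    then have "(\<lambda>x. \<exists>d \<in> D. move_offset (snd (ac i x)) = d \<and> snd (snd (c x) ! i) = p - d)
        \<in> and_span n ps4"
      by (intro and_span_disjoint_ex) (auto simp: D_def)
    moreover have "move_offset m \<in> D" for m by (cases m) (auto simp: D_def)
    then have "(\<lambda>x. \<exists>d \<in> D. move_offset (snd (ac i x)) = d \<and> snd (snd (c x) ! i) = p - d) =
        (\<lambda>x. snd (snd (tm_step M (c x)) ! i) = p)"
      by (auto simp: fun_eq_iff step [OF i] act_def)
    ultimately show ?thesis by simp
  qed
  have new_cell: "(\<lambda>x. fst (snd (tm_step M (c x)) ! i) p = a) \<in> and_span n ps4" if i: "i < K"
      for i p a
  proof (cases "p \<in> P \<and> a < G")
    case True
    \<comment> \<open>The update as a sum: the second term cancels the old content if the head is at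
      \<open>p\<close>, and the third inserts the written symbol.\<close>
    have "(\<lambda>x. ((fst (snd (c x) ! i) p = a) \<noteq>
          (snd (snd (c x) ! i) = p \<and> fst (snd (c x) ! i) p = a)) \<noteq>
          (snd (snd (c x) ! i) = p \<and> fst (ac i x) = a)) \<in> and_span n ps4"
      by (intro and_span_xor) (use True i ps1 ps4 ce sub4 in auto)
    moreover have "(\<lambda>x. fst (snd (tm_step M (c x)) ! i) p = a) =
        (\<lambda>x. ((fst (snd (c x) ! i) p = a) \<noteq>
          (snd (snd (c x) ! i) = p \<and> fst (snd (c x) ! i) p = a)) \<noteq>
          (snd (snd (c x) ! i) = p \<and> fst (ac i x) = a))"
      by (auto simp: fun_eq_iff step [OF i] act_def)
    ultimately show ?thesis by simp
  next
    case False
    \<comment> \<open>No head reaches a position outside \<open>P\<close>, and for a symbol outside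
      the alphabet both predicates are false.\<close>
    then have "(\<lambda>x. fst (snd (tm_step M (c x)) ! i) p = a) = (\<lambda>x. fst (snd (c x) ! i) p = a)"
      using headP [OF i] cell_less [OF i] ac_less [OF i]
      by (auto simp: fun_eq_iff step [OF i] act_def)
    then show ?thesis using ce i sub4 by auto
  qed
  have "tracked (ntapes M) n ps4 (\<lambda>x. tm_step M (c x))"
    using new_state new_head new_cell by (simp add: tracked_def K_def)
  moreover have "extends_by n ps (step_cost M * (2 * T + 1)) ps4"
  proof -
    have "extends_by n ps (card I1 + Suc K * card R + card I3 + card I4) ps4"
      by (intro extends_by_trans [OF _ ext4] extends_by_trans [OF _ ext3]
          extends_by_trans [OF ext1 ext2])
    moreover have "card D = 3" by (simp add: D_def)
    then have "card I1 + Suc K * card R + card I3 + card I4 =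
        2 * (K * G) * (2 * T + 1) + Suc K * (Q * G ^ K) + 3 * K * (2 * T + 1)"
      by (simp add: I1_def I3_def I4_def P R card_cartesian_product algebra_simps)
    moreover have "\<dots> \<le> step_cost M * (2 * T + 1)"
      by (simp add: step_cost_def K_def Q_def G_def add_mult_distrib)
    ultimately show ?thesis using extends_by_le by metis
  qed
  ultimately show ?thesis by blast
qed

lemma config_ok_init:
  assumes "tm_wf M" "set w \<subseteq> {..<nsyms M}"
  shows "config_ok M (init_config (ntapes M) w)"
proof -
  have "fst (input_tape w) p < nsyms M" for p
  proof (cases "0 \<le> p \<and> p < int (length w)")
    case True
    then have "w ! nat p \<in> set w" by (intro nth_mem) linarith
    then show ?thesis using True assms(2) by (auto simp: input_tape_def)
  qed (use assms(1) in \<open>auto simp: input_tape_def tm_wf_def\<close>)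
  moreover have "fst (input_tape []) p < nsyms M" for p
    using assms(1) by (auto simp: input_tape_def tm_wf_def)
  ultimately show ?thesis using assms(1)
    by (auto simp: config_ok_def init_config_def tm_wf_def nth_Cons split: nat.split)
qed

lemma tm_run_Suc: "tm_run M (Suc t) w = tm_step M (tm_run M t w)"
  by (simp add: tm_run_def)

lemma config_ok_run: "tm_wf M \<Longrightarrow> set w \<subseteq> {..<nsyms M} \<Longrightarrow> config_ok M (tm_run M t w)"
  by (induction t) (auto simp: tm_run_Suc config_ok_step, simp add: tm_run_def config_ok_init)

lemma head_run:
  assumes "tm_wf M" "set w \<subseteq> {..<nsyms M}" "i < ntapes M"
  shows "\<bar>snd (snd (tm_run M t w) ! i)\<bar> \<le> int t"
proof (induction t)
  case 0
  then show ?case using assms(1,3)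
    by (auto simp: tm_run_def init_config_def input_tape_def nth_Cons split: nat.split)
next
  case (Suc t)
  have "\<bar>move_offset m\<bar> \<le> 1" for m by (cases m) auto
  then have "\<bar>snd (act a tp)\<bar> \<le> \<bar>snd tp\<bar> + 1" for a tp
    unfolding act_def snd_conv by (metis abs_triangle_ineq add_left_mono order_trans)
  then have "\<bar>snd (snd (tm_run M (Suc t) w) ! i)\<bar> \<le> \<bar>snd (snd (tm_run M t w) ! i)\<bar> + 1"
    unfolding tm_run_Suc tm_step_config(3) [OF assms(1) config_ok_run [OF assms(1,2)] assms(3)] .
  then show ?case using Suc by simp
qed

text \<open>An affine input tape makes the initial configuration free, and then every step costs the
  same. The bound \<open>T\<close> on the head positions is fixed in advance, so that the cost does
  not depend on the step.\<close>

lemma tracked_run: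
  assumes wf: "tm_wf M" and syms: "\<And>x. set (w x) \<subseteq> {..<nsyms M}"
    and cells: "\<And>p a. (\<lambda>x. fst (input_tape (w x)) p = a) \<in> and_span n []"
    and "t \<le> T"
  shows "\<exists>ps. length ps \<le> t * (step_cost M * (2 * T + 1)) \<and>
           tracked (ntapes M) n ps (\<lambda>x. tm_run M t (w x))"
  using \<open>t \<le> T\<close>
proof (induction t)
  case 0
  have "tracked (ntapes M) n [] (\<lambda>x. init_config (ntapes M) (w x))"
    unfolding tracked_def
  proof (intro conjI allI impI)
    show "(\<lambda>x. fst (init_config (ntapes M) (w x)) = q) \<in> and_span n []" for q
      using and_span_const by (simp add: init_config_def)
    show "(\<lambda>x. fst (snd (init_config (ntapes M) (w x)) ! i) p = a) \<in> and_span n []"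
      if "i < ntapes M" for i p a
      using that cells and_span_const by (cases i) (auto simp: init_config_def)
    show "(\<lambda>x. snd (snd (init_config (ntapes M) (w x)) ! i) = p) \<in> and_span n []"
      if "i < ntapes M" for i p
      using that and_span_const by (cases i) (auto simp: init_config_def input_tape_def)
  qed
  then show ?case by (auto simp: tm_run_def)
next
  case (Suc t)
  then obtain ps where ps: "length ps \<le> t * (step_cost M * (2 * T + 1))"
    "tracked (ntapes M) n ps (\<lambda>x. tm_run M t (w x))" by auto
  have "\<bar>snd (snd (tm_run M t (w x)) ! i)\<bar> \<le> int T" if "i < ntapes M" for x i
    using head_run [OF wf syms that, of t x] Suc.prems by linarith
  from tracked_step [OF wf config_ok_run [OF wf syms] this ps(2)]
  obtain ps' where "extends_by n ps (step_cost M * (2 * T + 1)) ps'"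
    "tracked (ntapes M) n ps' (\<lambda>x. tm_run M (Suc t) (w x))" by (auto simp: tm_run_Suc)
  then show ?case using ps(1)
    by (intro exI [of _ ps']) (auto simp: extends_by_def simp del: mult_Suc_right)
qed

lemma mult_complexity_tm:
  assumes wf: "tm_wf M" and syms: "\<And>x. set (w x) \<subseteq> {..<nsyms M}"
    and cells: "\<And>p a. (\<lambda>x. fst (input_tape (w x)) p = a) \<in> and_span n []"
    and ans: "\<And>x. x \<in> cube n \<Longrightarrow> answers_within M T (w x) (f x)"
  shows "mult_complexity n f \<le> T * (step_cost M * (2 * T + 1))"
proof -
  obtain ps where ps: "length ps \<le> T * (step_cost M * (2 * T + 1))"
    "tracked (ntapes M) n ps (\<lambda>x. tm_run M T (w x))"
    using tracked_run [of M w n T T] wf syms cells by blast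
  have "(\<lambda>x. accepting (tm_run M T (w x))) \<in> and_span n ps"
    using ps(2) by (simp add: tracked_def accepting_def)
  then have "mult_complexity n f \<le> length ps"
    by (rule mult_complexity_le) (use ans in \<open>auto simp: answers_within_def\<close>)
  then show ?thesis using ps(1) by linarith
qed

lemma input_tape_in_and_span:
  assumes "\<And>x. w x = map (\<lambda>g. g x) gs" and "\<And>g a. g \<in> set gs \<Longrightarrow> (\<lambda>x. g x = a) \<in> and_span n ps"
  shows "(\<lambda>x. fst (input_tape (w x)) p = a) \<in> and_span n ps"
proof (cases "0 \<le> p \<and> p < int (length gs)")
  case True
  then have "(\<lambda>x. fst (input_tape (w x)) p = a) = (\<lambda>x. (gs ! nat p) x = a)"
    by (auto simp: input_tape_def assms(1))
  then show ?thesis using assms(2) True by (simp add: nat_less_iff)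
next
  case False
  then have "(\<lambda>x. fst (input_tape (w x)) p = a) = (\<lambda>x. blank = a)"
    by (auto simp: input_tape_def assms(1))
  then show ?thesis using and_span_const by metis
qed

lemma mult_complexity_restricted_family:
  assumes wf: "tm_wf M" and k: "k \<in> cube n" and "m \<le> n"
    and ans: "\<And>x. x \<in> cube n \<Longrightarrow> answers_within M T (map bit_sym k @ [sep] @ map bit_sym x) (f x)"
  shows "mult_complexity m (\<lambda>z. f (z @ replicate (n - m) False)) \<le> T * (step_cost M * (2 * T + 1))"
proof (rule mult_complexity_tm [OF wf])
  \<comment> \<open>Selecting the bits by index gives the word the same length for every list
    \<open>x\<close>. The span contains functions on all lists, so the tape cells must be affine
    also off the cube; the key and the padding are constants.\<close>
  define w where "w x =
      map bit_sym k @ [sep] @ map bit_sym (map (\<lambda>i. x ! i) [0..<m] @ replicate (n - m) False)"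
    for x
  show "set (w x) \<subseteq> {..<nsyms M}" for x
    using wf by (auto simp: w_def tm_wf_def bit_sym_def)
  show "answers_within M T (w x) (f (x @ replicate (n - m) False))" if "x \<in> cube m" for x
  proof -
    have "map (\<lambda>i. x ! i) [0..<m] = x" using that map_nth [of x] by (simp add: cube_def)
    then show ?thesis using ans [of "x @ replicate (n - m) False"] that \<open>m \<le> n\<close>
      by (simp add: w_def cube_def)
  qed
  define gs :: "(bool list \<Rightarrow> nat) list" where
    "gs = map (\<lambda>b x. bit_sym b) k @ [\<lambda>x. sep] @ map (\<lambda>i x. bit_sym (x ! i)) [0..<m] @
       replicate (n - m) (\<lambda>x. bit_sym False)"
  have bit: "(\<lambda>x :: bool list. bit_sym (x ! i) = a) \<in> and_span m []" if "i < m" for i a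
  proof -
    consider "a = 1" | "a = 2" | "a \<noteq> 1" "a \<noteq> 2" by blast
    then show ?thesis
    proof cases
      case 1
      then have "(\<lambda>x :: bool list. bit_sym (x ! i) = a) = (\<lambda>x. \<not> x ! i)" by (auto simp: bit_sym_def)
      then show ?thesis using and_span_not [OF and_span_input [OF that]] by simp
    next
      case 2
      then have "(\<lambda>x :: bool list. bit_sym (x ! i) = a) = (\<lambda>x. x ! i)" by (auto simp: bit_sym_def)
      then show ?thesis using and_span_input [OF that] by simp
    next
      case 3
      then have "(\<lambda>x :: bool list. bit_sym (x ! i) = a) = (\<lambda>x. False)" by (auto simp: bit_sym_def)
      then show ?thesis using and_span_False by simp
    qed
  qed
  show "(\<lambda>x. fst (input_tape (w x)) p = a) \<in> and_span m []" for p a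
  proof (rule input_tape_in_and_span [where gs = gs])
    show "w x = map (\<lambda>g. g x) gs" for x by (simp add: w_def gs_def)
    show "(\<lambda>x. g x = a) \<in> and_span m []" if "g \<in> set gs" for g a
      using that bit and_span_const by (auto simp: gs_def)
  qed
qed


section \<open>The distinguisher\<close>

definition cell :: "nat list \<Rightarrow> int \<Rightarrow> nat" where
  "cell w p = (if 0 \<le> p \<and> p < int (length w) then w ! nat p else blank)"

definition wtape :: "nat list \<Rightarrow> int \<Rightarrow> tape" where
  "wtape w p = (cell w, p)"

lemma input_tape_wtape: "input_tape w = wtape w 0"
  by (simp add: input_tape_def wtape_def cell_def fun_eq_iff)

lemma wtape_sel [simp]: "fst (wtape w p) = cell w" "snd (wtape w p) = p"
  by (simp_all add: wtape_def)

lemma cell_simps [simp]: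
  "cell w (-1) = blank" "cell w (int (length w)) = blank" "i < length w \<Longrightarrow> cell w (int i) = w ! i"
  by (simp_all add: cell_def)

lemma act_keep [simp]: "cell w p = a \<Longrightarrow> act (a, mv) (wtape w p) = wtape w (p + move_offset mv)"
  by (auto simp: act_def wtape_def)

lemma act_append: "act (a, mv) (wtape w (int (length w))) =
    wtape (w @ [a]) (int (length w) + move_offset mv)"
  by (auto simp: act_def wtape_def cell_def fun_eq_iff nth_append nat_less_iff)

lemma act_update:
  "i < length w \<Longrightarrow> act (a, mv) (wtape w (int i)) = wtape (w[i := a]) (int i + move_offset mv)"
  by (auto simp: act_def wtape_def cell_def fun_eq_iff nth_list_update nat_eq_iff)

abbreviation bit_word :: "bool list \<Rightarrow> nat list" where
  "bit_word \<equiv> map bit_sym"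

lemma bit_sym_simps [simp]: "bit_sym True = 2" "bit_sym False = 1"
  by (simp_all add: bit_sym_def)

text \<open>
  Tape 0 holds the input and tape 1 the query, tapes 4, 5, \<dots> are those of the simulated machine.
  Tape 2 counts the length \<open>n\<close> of the input in binary; its length times \<open>D\<close> is the number \<open>m\<close> of
  variables, stored in unary on tape 3. The query tape then runs through all \<open>m\<close>-bit words, padded
  with zeros.

  States 0, 6 and 7 scan the input and increment the counter on tape 2, state 8 rewinds the query,
  state \<open>16 + j\<close> writes the \<open>j\<close>-th of the \<open>D\<close> marks for a cell of tape 2, states 3, 4, 5, 10 and 9
  query, record the answer, increment the query word and rewind it, states 11 to 14 write
  \<open>2 ^ (m / 3)\<close> in binary, state 15 rewinds the input tape of the simulated machine, and its state
  \<open>q\<close>, unless it is halting, is represented by \<open>16 + D + q\<close>.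
\<close>

definition control ::
  "nat \<Rightarrow> nat \<Rightarrow> nat \<Rightarrow> nat \<Rightarrow> nat \<Rightarrow> nat \<Rightarrow> nat \<Rightarrow>
     nat \<times> (nat \<times> move) \<times> (nat \<times> move) \<times> (nat \<times> move) \<times> (nat \<times> move) \<times> (nat \<times> move)" where
  "control D q r0 r1 r2 r3 r4 =
    (let k0 = (r0, Stay); k1 = (r1, Stay); k2 = (r2, Stay); k3 = (r3, Stay); k4 = (r4, Stay) in
     if q = 0 then
       (if r0 = 0 then (8, k0, (r1, Move_Left), k2, k3, k4)
        else (6, (r0, Move_Right), (1, Move_Right), k2, k3, k4))
     else if q = 6 then
       (if r2 =
           2 then (6, k0, k1, (1, Move_Right), k3, k4) else (7, k0, k1, (2, Move_Left), k3, k4))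
     else if q = 7 then
       (if r2 = 0 then (0, k0, k1, (r2, Move_Right), k3, k4)
        else (7, k0, k1, (r2, Move_Left), k3, k4))
     else if q = 8 then
       (if r1 = 0 then (16, k0, (r1, Move_Right), k2, k3, k4)
        else (8, k0, (r1, Move_Left), k2, k3, k4))
     else if q = 9 then
       (if r3 = 0 then (3, k0, (r1, Move_Right), k2, (r3, Move_Right), k4)
        else (9, k0, (r1, Move_Left), k2, (r3, Move_Left), k4))
     else if q = 4 then (10, k0, k1, k2, k3, (2, Move_Right))
     else if q = 5 then (10, k0, k1, k2, k3, (1, Move_Right))
     else if q = 10 then
       (if r3 = 0 then (11, k0, k1, k2, k3, (3, Move_Right))
        else if r1 = 2 then (10, k0, (1, Move_Right), k2, (r3, Move_Right), k4)
        else (9, k0, (2, Move_Left), k2, (r3, Move_Left), k4))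
     else if q = 11 then (12, k0, k1, k2, (r3, Move_Left), (2, Move_Right))
     else if q = 12 then
       (if r3 = 0 then (15, k0, k1, k2, k3, (r4, Move_Left))
        else (13, k0, k1, k2, (r3, Move_Left), (1, Move_Right)))
     else if q = 13 then (14, k0, k1, k2, (r3, Move_Left), k4)
     else if q = 14 then (12, k0, k1, k2, (r3, Move_Left), k4)
     else if q = 15 then
       (if r4 = 0 then (16 + D, k0, k1, k2, k3, (r4, Move_Right))
        else (15, k0, k1, k2, k3, (r4, Move_Left)))
     else if 16 \<le> q then
       (if r2 = 0 then (9, k0, (r1, Move_Left), k2, (r3, Move_Left), k4)
        else if Suc (q - 16) =
            D then (16, k0, (1, Move_Right), (r2, Move_Right), (1, Move_Right), k4)
        else (Suc q, k0, (1, Move_Right), k2, (1, Move_Right), k4))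
     else (2, k0, k1, k2, k3, k4))"

definition embed_state :: "nat \<Rightarrow> nat \<Rightarrow> nat" where
  "embed_state D q = (if q = accept_state \<or> q = reject_state then q else 16 + D + q)"

text \<open>Tape 4 is output tape of the control part and input tape of \<open>M\<close>; hence
  \<open>drop 5\<close> in the first branch and \<open>drop 4\<close> in the second.\<close>

definition dist_delta :: "tm \<Rightarrow> nat \<Rightarrow> transition" where
  "dist_delta M D q rs =
     (if q < 16 + D then
        case control D q (rs ! 0) (rs ! 1) (rs ! 2) (rs ! 3) (rs ! 4) of
          (q', a0, a1, a2, a3, a4) \<Rightarrow> (q', [a0, a1, a2, a3, a4] @ map (\<lambda>r. (r, Stay)) (drop 5 rs))
      else
        case delta M (q - (16 + D)) (drop 4 rs) of
          (q', as) \<Rightarrow> (embed_state D q', map (\<lambda>r. (r, Stay)) (take 4 rs) @ as))"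

definition distinguisher :: "tm \<Rightarrow> nat \<Rightarrow> potm" where
  "distinguisher M D =
     \<lparr>ntapes = 4 + ntapes M, nstates = 16 + D + nstates M, nsyms = nsyms M,
      delta = dist_delta M D, delta' = dist_delta M D\<rparr>"

lemma control_bounds:
  assumes "q < 16 + D" "0 < D" "0 < Q" "4 \<le> G" "r0 < G" "r1 < G" "r2 < G" "r3 < G" "r4 < G"
  shows "case control D q r0 r1 r2 r3 r4 of (q', a0, a1, a2, a3, a4) \<Rightarrow>
    q' < 16 + D + Q \<and> fst a0 < G \<and> fst a1 < G \<and> fst a2 < G \<and> fst a3 < G \<and> fst a4 < G"
  using assms unfolding control_def Let_def
  by (auto split: if_splits)

lemma distinguisher_wf:
  assumes "tm_wf M" "0 < D"
  shows "potm_wf (distinguisher M D)"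
proof -
  let ?K = "4 + ntapes M" and ?Q = "16 + D + nstates M" and ?G = "nsyms M"
  have M: "1 \<le> ntapes M" "3 \<le> nstates M" "4 \<le> nsyms M"
    and tr: "transition_wf (ntapes M) (nstates M) (nsyms M) (delta M)"
    using assms(1) by (auto simp: tm_wf_def)
  have "fst (dist_delta M D q rs) < ?Q \<and> length (snd (dist_delta M D q rs)) = ?K \<and>
      fst ` set (snd (dist_delta M D q rs)) \<subseteq> {..<?G}"
    if q: "q < ?Q" and rs: "length rs = ?K" "set rs \<subseteq> {..<?G}" for q rs
  proof (cases "q < 16 + D")
    case True
    have r: "rs ! i < ?G" if "i < 5" for i
    proof -
      have "i < length rs" using rs(1) M(1) that by simp
      then show ?thesis using nth_mem rs(2) by blast
    qed
    obtain q' a0 a1 a2 a3 a4 where c: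
      "control D q (rs ! 0) (rs ! 1) (rs ! 2) (rs ! 3) (rs ! 4) = (q', a0, a1, a2, a3, a4)"
      by (metis prod_cases6)
    have "q' < ?Q \<and> fst a0 < ?G \<and> fst a1 < ?G \<and> fst a2 < ?G \<and> fst a3 < ?G \<and> fst a4 < ?G"
      using control_bounds [of q D "nstates M" ?G "rs ! 0" "rs ! 1" "rs ! 2" "rs ! 3" "rs ! 4"]
        True assms(2) M r c by simp
    moreover have "set (drop 5 rs) \<subseteq> {..<?G}" using rs(2) set_drop_subset by fast
    ultimately show ?thesis using True c rs(1) M(1) by (auto simp: dist_delta_def)
  next
    case False
    obtain q' as where d: "delta M (q - (16 + D)) (drop 4 rs) = (q', as)" by fastforce
    have "set (drop 4 rs) \<subseteq> {..<?G}" "set (take 4 rs) \<subseteq> {..<?G}"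
      using rs(2) set_drop_subset set_take_subset by fast+
    moreover from this(1) have "q' < nstates M \<and> length as = ntapes M \<and> fst ` set as \<subseteq> {..<?G}"
      using tr q rs(1) False d unfolding transition_wf_def
      by (metis add_diff_cancel_left' fst_conv length_drop less_diff_conv2 linorder_not_less
          add.commute snd_conv)
    ultimately show ?thesis using False d rs(1)
      by (auto simp: dist_delta_def embed_state_def)
  qed
  then have "transition_wf ?K ?Q ?G (dist_delta M D)" by (simp add: transition_wf_def)
  then show ?thesis using M by (simp add: potm_wf_def distinguisher_def)
qed


section \<open>Binary counters\<close>

fun inc :: "bool list \<Rightarrow> bool list" where
  "inc [] = [True]"
| "inc (False # bs) = True # bs"
| "inc (True # bs) = False # inc bs"

text \<open>The content of the counter after \<open>n\<close> increments, least significant bit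
  first and without leading zeros. Only the length of this word enters the parameters.\<close>

definition bits :: "nat \<Rightarrow> bool list" where
  "bits n = (inc ^^ n) []"

lemma bits_simps [simp]: "bits 0 = []" "bits (Suc n) = inc (bits n)"
  by (simp_all add: bits_def)

lemma length_inc: "length (inc bs) \<le> Suc (length bs)"
  by (induction bs rule: inc.induct) auto

lemma length_bits_le: "length (bits n) \<le> n"
  by (induction n) (use length_inc le_trans in \<open>fastforce+\<close>)

fun bits_value :: "bool list \<Rightarrow> nat" where
  "bits_value [] = 0"
| "bits_value (b # bs) = of_bool b + 2 * bits_value bs"

lemma bits_value_inc: "bits_value (inc bs) = Suc (bits_value bs)"
  by (induction bs rule: inc.induct) auto

lemma bits_value_bits: "bits_value (bits n) = n"
  by (induction n) (auto simp: bits_value_inc)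

lemma bits_value_less: "bits_value bs < 2 ^ length bs"
  by (induction bs) auto

lemma bits_value_ge: "bs \<noteq> [] \<Longrightarrow> last bs \<Longrightarrow> 2 ^ length bs \<le> 2 * bits_value bs"
  by (induction bs) (auto split: if_splits)

lemma inc_last: "bs = [] \<or> last bs \<Longrightarrow> inc bs \<noteq> [] \<and> last (inc bs)"
  by (induction bs rule: inc.induct) (auto split: if_splits)

lemma bits_last: "bits n = [] \<or> last (bits n)"
  by (induction n) (use inc_last in \<open>auto simp del: inc.simps\<close>)

text \<open>This bound lifts the threshold \<open>2 ^ (c * L)\<close>, with \<open>L\<close> the
  length of the counter, to at least \<open>n ^ c\<close>. The next one keeps \<open>2 ^ m\<close>
  polynomial in \<open>n\<close>; its summand 1 covers \<open>n = 0\<close>.\<close>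

lemma less_two_power_bits: "n < 2 ^ length (bits n)"
  using bits_value_less [of "bits n"] by (simp add: bits_value_bits)

lemma two_power_bits_le: "2 ^ length (bits n) \<le> 2 * n + 1"
  using bits_last [of n] bits_value_ge [of "bits n"] by (cases "bits n =
      []") (auto simp: bits_value_bits)

fun lsb_bits :: "nat \<Rightarrow> nat \<Rightarrow> bool list" where
  "lsb_bits 0 v = []"
| "lsb_bits (Suc k) v = odd v # lsb_bits k (v div 2)"

lemma length_lsb_bits [simp]: "length (lsb_bits k v) = k"
  by (induction k arbitrary: v) auto

lemma lsb_bits_0: "lsb_bits k 0 = replicate k False"
  by (induction k) auto

lemma concat_pairs: "concat (map (\<lambda>i. [f (2 * i), f (Suc (2 * i))]) [0..<k]) = map f [0..<2 * k]"
  by (induction k) auto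

text \<open>The first coordinate varies fastest in \<open>List.n_lists\<close>, so a counter with
  its least significant bit in front visits the points in the order of the truth table.\<close>

lemma n_lists_lsb_bits: "List.n_lists m [False, True] = map (lsb_bits m) [0..<2 ^ m]"
proof (induction m)
  case (Suc m)
  have "List.n_lists (Suc m) [False, True] =
      concat (map (\<lambda>i. [lsb_bits (Suc m) (2 * i), lsb_bits (Suc m) (Suc (2 * i))]) [0..<2 ^ m])"
    by (simp add: Suc comp_def)
  then show ?case by (simp only: concat_pairs power_Suc)
qed simp

text \<open>The reason for a threshold that is a power of two: its binary form is a single 1
  followed by zeros, which can be written by counting.\<close>

lemma binary_power: "binary (2 ^ e) = True # replicate e False"
proof (induction e)
  case 0
  then show ?case by (simp add: binary.simps [of "Suc 0"] binary.simps [of 0])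
next
  case (Suc e)
  have "binary (2 ^ Suc e) = binary (2 ^ e) @ [False]"
    by (subst binary.simps) simp
  then show ?case by (simp add: Suc replicate_append_same)
qed


section \<open>Runs of the distinguisher\<close>

lemma holds_word_unique:
  assumes "holds_word (wtape (bit_word y) p) x"
  shows "x = y"
proof (rule nth_equalityI)
  have b: "bit_sym b \<noteq> 0" for b by (simp add: bit_sym_def)
  have end_blank: "cell (bit_word y) (int (length x)) = 0"
    and eq: "\<And>i. i < length x \<Longrightarrow> cell (bit_word y) (int i) = bit_sym (x ! i)"
    using assms by (auto simp: holds_word_def)
  have "length y \<le> length x" using end_blank b [of "y ! length x"]
      by (auto simp: cell_def split: if_splits)
  moreover have "\<not> length y < length x"
    using eq [of "length y"] b by (auto simp: cell_def split: if_splits)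
  ultimately show len: "length x = length y" by simp
  show "x ! i = y ! i" if "i < length x" for i
    using eq [OF that] that len by (auto simp: cell_def bit_sym_def split: if_splits)
qed

lemma oracle_answer_wtape: "oracle_answer H (wtape (bit_word y) p) \<longleftrightarrow> H y"
proof -
  have "holds_word (wtape (bit_word y) p) y"
    using cell_simps(2) [of "bit_word y"] by (auto simp: holds_word_def)
  then show ?thesis using holds_word_unique by (auto simp: oracle_answer_def)
qed

section \<open>Reachability with time bounds\<close>

definition reaches :: "('a \<Rightarrow> 'a) \<Rightarrow> nat \<Rightarrow> 'a \<Rightarrow> 'a \<Rightarrow> bool" where
  "reaches f t c c' \<longleftrightarrow> (\<exists>t' \<le> t. (f ^^ t') c = c')"

lemma reaches_refl: "reaches f t c c"
  by (auto simp: reaches_def intro: exI [of _ 0])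

lemma reaches_trans: "reaches f t c c' \<Longrightarrow> reaches f u c' c'' \<Longrightarrow> reaches f (t + u) c c''"
proof -
  assume "reaches f t c c'" "reaches f u c' c''"
  then obtain t' u' where "t' \<le> t" "u' \<le> u" "(f ^^ t') c = c'" "(f ^^ u') c' = c''"
    by (auto simp: reaches_def)
  then show ?thesis unfolding reaches_def
    by (intro exI [of _ "u' + t'"]) (auto simp: funpow_add)
qed

lemma reaches_step: "f c = c' \<Longrightarrow> reaches f t c' c'' \<Longrightarrow> reaches f (Suc t) c c''"
  using reaches_trans [of f 1 c c' t c''] by (force simp: reaches_def)

lemma reaches_1: "f c = c' \<Longrightarrow> reaches f 1 c c'"
  by (auto simp: reaches_def intro: exI [of _ 1])

lemma reaches_le: "reaches f t c c' \<Longrightarrow> t \<le> u \<Longrightarrow> reaches f u c c'"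
  unfolding reaches_def using le_trans by blast

definition dstep :: "tm \<Rightarrow> nat \<Rightarrow> (bool list \<Rightarrow> bool) \<Rightarrow> config \<Rightarrow> config" where
  "dstep M D H = potm_step (distinguisher M D) H False"

lemma dstep_control:
  assumes "q < 16 + D" "q \<noteq> 1" "q \<noteq> 2" "q \<noteq> 3"
  shows "dstep M D H (q, t0 # t1 # t2 # t3 # t4 # ts) =
    (case control D q (fst t0 (snd t0)) (fst t1 (snd t1)) (fst t2 (snd t2)) (fst t3 (snd t3))
        (fst t4 (snd t4)) of
      (q', a0, a1, a2, a3, a4) \<Rightarrow> (q', act a0 t0 # act a1 t1 # act a2 t2 # act a3 t3 # act a4 t4 #
          ts))"
proof -
  have "map2 act (map (\<lambda>r. (r, Stay)) (map (\<lambda>tp. fst tp (snd tp)) ts)) ts = ts"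
    by (rule nth_equalityI) auto
  then show ?thesis using assms
    by (auto simp: dstep_def potm_step_def halted_def apply_transition_def distinguisher_def
        dist_delta_def split: prod.splits)
qed

lemmas dstep_simps = dstep_control control_def Let_def act_append act_update

lemma bit_word_nonblank: "a \<in> set (bit_word bs) \<Longrightarrow> a \<noteq> blank"
  by (auto simp: bit_sym_def)

lemma nonblank_cell: "(\<And>a. a \<in> set w \<Longrightarrow> a \<noteq> blank) \<Longrightarrow> i < length w \<Longrightarrow> cell w (int i) \<noteq> blank"
  by auto

text \<open>\<open>pre\<close> holds the bits already passed by the carry. The head ends at
  \<open>int k - 1\<close>, where \<open>k = 0\<close> stands for the blank to the left of the word;
  this is the form that the rewinding lemmas start from.\<close>

lemma ruler_increment:
  "\<exists>k \<le> length (pre @ inc bs). reaches (dstep M D H) (Suc (length bs))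
     (6, t0 # t1 # wtape (bit_word (pre @ bs)) (int (length pre)) # t3 # t4 # ts)
     (7, t0 # t1 # wtape (bit_word (pre @ inc bs)) (int k - 1) # t3 # t4 # ts)"
proof (induction bs arbitrary: pre rule: inc.induct)
  case 1
  have "dstep M D H (6, t0 # t1 # wtape (bit_word pre) (int (length pre)) # t3 # t4 # ts) =
     (7, t0 # t1 # wtape (bit_word (pre @ [True])) (int (length pre) - 1) # t3 # t4 # ts)"
    using act_append [of 2 Move_Left "bit_word pre"] cell_simps(2) [of "bit_word pre"]
    by (simp add: dstep_simps)
  then show ?case
    by (intro exI [of _ "length pre"]) (auto intro!: reaches_step [OF _ reaches_refl])
next
  case (2 bs)
  have "cell (bit_word (pre @ False # bs)) (int (length pre)) = 1"
    using cell_simps(3) [of "length pre" "bit_word (pre @ False # bs)"] by (simp add: nth_append)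
  then have "dstep M D H (6, t0 # t1 # wtape (bit_word (pre @ False # bs)) (int (length pre)) #
      t3 # t4 # ts) =
     (7, t0 # t1 # wtape (bit_word (pre @ True # bs)) (int (length pre) - 1) # t3 # t4 # ts)"
    using act_update [of "length pre" "bit_word (pre @ False # bs)" 2 Move_Left]
    by (simp add: dstep_simps list_update_append add.commute)
  then show ?case
    by (intro exI [of _ "length pre"]) (auto intro!: reaches_step [OF _ reaches_refl])
next
  case (3 bs)
  have "cell (bit_word (pre @ True # bs)) (int (length pre)) = 2"
    using cell_simps(3) [of "length pre" "bit_word (pre @ True # bs)"] by (simp add: nth_append)
  then have "dstep M D H (6, t0 # t1 # wtape (bit_word (pre @ True # bs)) (int (length pre)) #
      t3 # t4 # ts) =
     (6, t0 # t1 # wtape (bit_word ((pre @ [False]) @ bs)) (int (length (pre @ [False]))) # t3 #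
         t4 # ts)"
    using act_update [of "length pre" "bit_word (pre @ True # bs)" 1 Move_Right]
    by (simp add: dstep_simps list_update_append add.commute)
  then show ?case using "3.IH" [of "pre @ [False]"] by (auto intro!: reaches_step)
qed

lemma ruler_rewind:
  assumes "\<And>a. a \<in> set w \<Longrightarrow> a \<noteq> blank" "k \<le> length w"
  shows "reaches (dstep M D H) (Suc k)
     (7, t0 # t1 # wtape w (int k - 1) # t3 # t4 # ts) (0, t0 # t1 # wtape w 0 # t3 # t4 # ts)"
  using assms(2)
proof (induction k)
  case 0
  show ?case by (rule reaches_step [OF _ reaches_refl]) (simp add: dstep_simps)
next
  case (Suc k)
  show ?case
    by (rule reaches_step [OF _ Suc.IH]) (use Suc.prems nonblank_cell [OF assms(1)] in \<open>auto simp: dstep_simps\<close>)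
qed

text \<open>Besides the counter, each input symbol leaves a 1, the code of \<open>False\<close>, on
  the query tape. At the end that tape holds the all-zero query of full length.\<close>

lemma scan_input:
  assumes "i \<le> length w"
  shows "reaches (dstep M D H) (i * (2 * length w + 4))
     (0, wtape (bit_word w) 0 # wtape [] 0 # wtape [] 0 # t3 # t4 # ts)
     (0, wtape (bit_word w) (int i) # wtape (replicate i 1) (int i) #
         wtape (bit_word (bits i)) 0 # t3 # t4 # ts)"
  using assms
proof (induction i)
  case 0
  show ?case using reaches_refl by simp
next
  case (Suc i)
  let ?S = "dstep M D H"
  let ?t0 = "wtape (bit_word w) (int (Suc i))" and ?t1 = "wtape (replicate (Suc i) 1) (int (Suc i))"
  let ?c = "(0, wtape (bit_word w) (int i) # wtape (replicate i 1) (int i) #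
      wtape (bit_word (bits i)) 0 # t3 # t4 # ts)"
  obtain k where k: "k \<le> length (inc (bits i))" and r: "reaches ?S (Suc (length (bits i)))
     (6, ?t0 # ?t1 # wtape (bit_word (bits i)) 0 # t3 # t4 # ts)
     (7, ?t0 # ?t1 # wtape (bit_word (inc (bits i))) (int k - 1) # t3 # t4 # ts)"
    using ruler_increment [of "[]" "bits i" M D H ?t0 ?t1 t3 t4 ts] by auto
  have "?S ?c = (6, ?t0 # ?t1 # wtape (bit_word (bits i)) 0 # t3 # t4 # ts)"
    using Suc.prems nonblank_cell [of "bit_word w" i] bit_word_nonblank [of _ w] act_append [of 1 Move_Right "replicate i 1"]
    by (simp add: dstep_simps replicate_append_same add.commute)
  then have "reaches ?S (Suc (Suc (length (bits i)) + Suc k)) ?c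
     (0, ?t0 # ?t1 # wtape (bit_word (inc (bits i))) 0 # t3 # t4 # ts)"
    by (rule reaches_step) (rule reaches_trans [OF r], rule ruler_rewind, use k bit_word_nonblank in auto)
  moreover have "Suc (Suc (length (bits i)) + Suc k) \<le> 2 * length w + 4"
    using k length_inc [of "bits i"] length_bits_le [of i] Suc.prems by linarith
  ultimately have "reaches ?S (2 * length w + 4) ?c
     (0, ?t0 # ?t1 # wtape (bit_word (bits (Suc i))) 0 # t3 # t4 # ts)"
    unfolding bits_simps by (rule reaches_le)
  from reaches_trans [OF Suc.IH this] show ?case using Suc.prems by (simp add: add.commute)
qed

lemma query_rewind:
  assumes "\<And>a. a \<in> set w \<Longrightarrow> a \<noteq> blank" "k \<le> length w"
  shows "reaches (dstep M D H) (Suc k)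
     (8, t0 # wtape w (int k - 1) # t2 # t3 # t4 # ts) (16, t0 # wtape w 0 # t2 # t3 # t4 # ts)"
  using assms(2)
proof (induction k)
  case 0
  show ?case by (rule reaches_step [OF _ reaches_refl]) (simp add: dstep_simps)
next
  case (Suc k)
  show ?case
    by (rule reaches_step [OF _ Suc.IH]) (use Suc.prems nonblank_cell [OF assms(1)] in \<open>auto simp: dstep_simps\<close>)
qed

text \<open>The counter serves as a ruler: only its length matters, and each of its cells yields
  \<open>D\<close> marks. The state keeps \<open>k mod D\<close> and the head on the ruler
  \<open>k div D\<close>. The query word grows only where the marks outrun it, hence
  \<open>max n k\<close>.\<close>

lemma expand_ruler:
  assumes "\<And>a. a \<in> set r \<Longrightarrow> a \<noteq> blank" "0 < D" "k \<le> D * length r"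
  shows "reaches (dstep M D H) k
     (16, t0 # wtape (replicate n 1) 0 # wtape r 0 # wtape [] 0 # t4 # ts)
     (16 + k mod D, t0 # wtape (replicate (max n k) 1) (int k) # wtape r (int (k div D)) #
        wtape (replicate k 1) (int k) # t4 # ts)"
  using assms(3)
proof (induction k)
  case 0
  show ?case using reaches_refl by simp
next
  case (Suc k)
  let ?c = "\<lambda>k. (16 + k mod D, t0 # wtape (replicate (max n k) 1) (int k) #
      wtape r (int (k div D)) #
        wtape (replicate k 1) (int k) # t4 # ts)"
  have "k div D < length r" using Suc.prems
      by (simp add: div_less_iff_less_mult assms(2) mult.commute)
  then have ruler: "cell r (int (k div D)) \<noteq> blank" using nonblank_cell [OF assms(1)] by blast
  have query: "act (1, Move_Right) (wtape (replicate (max n k) 1) (int k)) =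
      wtape (replicate (max n (Suc k)) 1) (int (Suc k))"
  proof (cases "k < n")
    case True
    then have "max n k = n" "max n (Suc k) = n" by auto
    moreover have "(replicate n 1)[k := 1] = replicate n (1 :: nat)"
      using True by (metis list_update_id nth_replicate)
    ultimately show ?thesis using True act_update [of k "replicate n 1" 1 Move_Right]
      by (simp add: add.commute)
  next
    case False
    then have "max n k = k" "max n (Suc k) = Suc k" by auto
    then show ?thesis using act_append [of 1 Move_Right "replicate k 1"]
      by (simp add: replicate_append_same add.commute)
  qed
  have marks: "act (1, Move_Right) (wtape (replicate k 1) (int k)) =
      wtape (replicate (Suc k) 1) (int (Suc k))"
    using act_append [of 1 Move_Right "replicate k 1"]
        by (simp add: replicate_append_same add.commute)
  have "k mod D < D" using assms(2) by simp
  then have "dstep M D H (?c k) = ?c (Suc k)"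
    using ruler query marks
        by (auto simp: dstep_control control_def Let_def mod_Suc div_Suc add.commute)
  then have "reaches (dstep M D H) 1 (?c k) (?c (Suc k))"
    by (rule reaches_1)
  from reaches_trans [OF Suc.IH this] show ?case using Suc.prems by simp
qed

lemma counter_rewind:
  assumes "\<And>a. a \<in> set v \<Longrightarrow> a \<noteq> blank" "k \<le> length v"
  shows "reaches (dstep M D H) (Suc k)
     (9, t0 # wtape w (int k - 1) # t2 # wtape v (int k - 1) # t4 # ts)
     (3, t0 # wtape w 0 # t2 # wtape v 0 # t4 # ts)"
  using assms(2)
proof (induction k)
  case 0
  show ?case
    by (intro reaches_step [OF _ reaches_refl]) (simp add: dstep_simps)
next
  case (Suc k)
  show ?case
    by (rule reaches_step [OF _ Suc.IH]) (use Suc.prems nonblank_cell [OF assms(1)] in \<open>auto simp: dstep_simps\<close>)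
qed

text \<open>The head on the marks runs in step with the head on the query, so the carry stops after
  \<open>m\<close> bits and leaves the padding alone. Running off the marks in state 10 signals
  overflow, that is, the end of the enumeration.\<close>

lemma counter_increment:
  assumes "v < 2 ^ k" "length pre + k = m"
  shows "\<exists>q p. reaches (dstep M D H) k
     (10, t0 # wtape (bit_word (pre @ lsb_bits k v @ pad)) (int (length pre)) # t2 #
        wtape (replicate m 1) (int (length pre)) # t4 # ts)
     (q, t0 # wtape (bit_word (pre @ lsb_bits k (Suc v) @ pad)) p # t2 #
        wtape (replicate m 1) p # t4 # ts) \<and>
     (if Suc v = 2 ^ k then q = 10 \<and> p = int m else q = 9 \<and> (\<exists>i \<le> m. p = int i - 1))"
  using assms
proof (induction k arbitrary: pre v)
  case 0
  then show ?case using reaches_refl by auto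
next
  case (Suc k)
  let ?w = "bit_word (pre @ lsb_bits (Suc k) v @ pad)"
  have mark: "cell (replicate m 1) (int (length pre)) = 1" using Suc.prems(2) by simp
  have cell: "cell ?w (int (length pre)) = bit_sym (odd v)"
    using cell_simps(3) [of "length pre" ?w] by (simp add: nth_append)
  show ?case
  proof (cases "odd v")
    case True
    let ?pre = "pre @ [False]"
    have v: "v div 2 < 2 ^ k" "Suc (v div 2) = 2 ^ k \<longleftrightarrow> Suc v = 2 ^ Suc k"
      "Suc v div 2 = Suc (v div 2)"
      using Suc.prems(1) True by (auto elim!: oddE)
    have step: "dstep M D H (10, t0 # wtape ?w (int (length pre)) # t2 #
        wtape (replicate m 1) (int (length pre)) # t4 # ts) =
      (10, t0 # wtape (bit_word (?pre @ lsb_bits k (v div 2) @ pad)) (int (length ?pre)) # t2 #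
        wtape (replicate m 1) (int (length ?pre)) # t4 # ts)"
      using mark cell True act_update [of "length pre" ?w 1 Move_Right]
      by (simp add: dstep_control control_def Let_def list_update_append add.commute)
    obtain q p where qp: "reaches (dstep M D H) k
       (10, t0 # wtape (bit_word (?pre @ lsb_bits k (v div 2) @ pad)) (int (length ?pre)) # t2 #
          wtape (replicate m 1) (int (length ?pre)) # t4 # ts)
       (q, t0 # wtape (bit_word (?pre @ lsb_bits k (Suc (v div 2)) @ pad)) p # t2 #
          wtape (replicate m 1) p # t4 # ts)"
      "if Suc (v div 2) = 2 ^ k then q = 10 \<and> p = int m else q = 9 \<and> (\<exists>i \<le> m. p = int i - 1)"
      using Suc.IH [of "v div 2" ?pre] Suc.prems(2) v(1) by auto
    have "?pre @ lsb_bits k (Suc (v div 2)) @ pad = pre @ lsb_bits (Suc k) (Suc v) @ pad"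
      using True v(3) by simp
    then show ?thesis
      using reaches_step [where f = "dstep M D H", OF step qp(1)] qp(2) v(2) by metis
  next
    case False
    have "even ((2 :: nat) ^ Suc k)" by simp
    then have v: "Suc v \<noteq> 2 ^ Suc k" "Suc v div 2 = v div 2"
      using False even_Suc [of v] by (metis, auto elim!: evenE)
    have step: "dstep M D H (10, t0 # wtape ?w (int (length pre)) # t2 #
        wtape (replicate m 1) (int (length pre)) # t4 # ts) =
      (9, t0 # wtape (bit_word (pre @ lsb_bits (Suc k) (Suc v) @ pad)) (int (length pre) - 1) # t2 #
        wtape (replicate m 1) (int (length pre) - 1) # t4 # ts)"
      using mark cell False v act_update [of "length pre" ?w 2 Move_Left]
      by (simp add: dstep_control control_def Let_def list_update_append add.commute)
    have "\<exists>i \<le> m. int (length pre) - 1 = int i - 1" using Suc.prems(2) by auto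
    then show ?thesis
      using v(1) reaches_step [where f = "dstep M D H", OF step reaches_refl [of _ k]]
      by (intro exI [of _ 9] exI [of _ "int (length pre) - 1"] conjI) simp_all
  qed
qed

lemma query_step:
  "reaches (dstep M D H) 2
     (3, t0 # wtape (bit_word y) p # t2 # t3 # wtape (bit_word tt) (int (length tt)) # ts)
     (10, t0 # wtape (bit_word y) p # t2 # t3 #
         wtape (bit_word (tt @ [H y])) (int (length (tt @ [H y]))) # ts)"
proof -
  let ?t1 = "wtape (bit_word y) p" and ?t4 = "wtape (bit_word tt) (int (length tt))"
  have "dstep M D H (3, t0 # ?t1 # t2 # t3 # ?t4 # ts) =
      (if H y then 4 else 5, t0 # ?t1 # t2 # t3 # ?t4 # ts)"
    by (simp add: dstep_def potm_step_def halted_def oracle_answer_wtape)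
  moreover have "dstep M D H (if H y then 4 else 5, t0 # ?t1 # t2 # t3 # ?t4 # ts) =
      (10, t0 # ?t1 # t2 # t3 # wtape (bit_word (tt @ [H y])) (int (length (tt @ [H y]))) # ts)"
    using act_append [of "bit_sym (H y)" Move_Right "bit_word tt"]
    by (cases "H y") (simp_all add: dstep_control control_def Let_def add.commute)
  ultimately show ?thesis
    using reaches_step [OF _ reaches_step [OF _ reaches_refl, of _ _ _ 0]] by (metis numeral_2_eq_2)
qed

text \<open>A round takes 2 steps for the query, at most \<open>m\<close> for the increment and at
  most \<open>m + 1\<close> for rewinding.\<close>

lemma query_loop:
  assumes "i < 2 ^ m"
  shows "reaches (dstep M D H) (i * (2 * m + 3))
     (3, t0 # wtape (bit_word (lsb_bits m 0 @ pad)) 0 # t2 # wtape (replicate m 1) 0 #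
         wtape [] 0 # ts)
     (3, t0 # wtape (bit_word (lsb_bits m i @ pad)) 0 # t2 # wtape (replicate m 1) 0 #
        wtape (bit_word (map (\<lambda>j. H (lsb_bits m j @ pad)) [0..<i])) (int i) # ts)"
  using assms
proof (induction i)
  case 0
  show ?case using reaches_refl by simp
next
  case (Suc i)
  let ?tt = "\<lambda>i. map (\<lambda>j. H (lsb_bits m j @ pad)) [0..<i]"
  let ?t4 = "wtape (bit_word (?tt (Suc i))) (int (Suc i))"
  have q: "reaches (dstep M D H) 2
     (3, t0 # wtape (bit_word (lsb_bits m i @ pad)) 0 # t2 # wtape (replicate m 1) 0 #
        wtape (bit_word (?tt i)) (int i) # ts)
     (10, t0 # wtape (bit_word (lsb_bits m i @ pad)) 0 # t2 # wtape (replicate m 1) 0 # ?t4 # ts)"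
    using query_step [of M D H t0 "lsb_bits m i @ pad" 0 t2 "wtape (replicate m 1) 0" "?tt i" ts]
        by simp
  obtain k where k: "k \<le> m" and r: "reaches (dstep M D H) m
     (10, t0 # wtape (bit_word (lsb_bits m i @ pad)) 0 # t2 # wtape (replicate m 1) 0 # ?t4 # ts)
     (9, t0 # wtape (bit_word (lsb_bits m (Suc i) @ pad)) (int k - 1) # t2 #
        wtape (replicate m 1) (int k - 1) # ?t4 # ts)"
    using counter_increment [of i m "[]" m M D H t0 pad t2 ?t4 ts] Suc.prems by auto
  have "reaches (dstep M D H) (Suc k)
     (9, t0 # wtape (bit_word (lsb_bits m (Suc i) @ pad)) (int k - 1) # t2 #
        wtape (replicate m 1) (int k - 1) # ?t4 # ts)
     (3, t0 # wtape (bit_word (lsb_bits m (Suc i) @ pad)) 0 # t2 # wtape (replicate m 1) 0 # ?t4 #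
         ts)"
    by (rule counter_rewind) (use k in auto)
  then have "reaches (dstep M D H) (2 + m + Suc k)
     (3, t0 # wtape (bit_word (lsb_bits m i @ pad)) 0 # t2 # wtape (replicate m 1) 0 #
        wtape (bit_word (?tt i)) (int i) # ts)
     (3, t0 # wtape (bit_word (lsb_bits m (Suc i) @ pad)) 0 # t2 # wtape (replicate m 1) 0 # ?t4 #
         ts)"
    using reaches_trans [OF reaches_trans [OF q r]] by blast
  from reaches_trans [OF Suc.IH this] Suc.prems
  have "reaches (dstep M D H) (i * (2 * m + 3) + (2 + m + Suc k))
     (3, t0 # wtape (bit_word (lsb_bits m 0 @ pad)) 0 # t2 # wtape (replicate m 1) 0 #
         wtape [] 0 # ts)
     (3, t0 # wtape (bit_word (lsb_bits m (Suc i) @ pad)) 0 # t2 # wtape (replicate m 1) 0 # ?t4 #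
         ts)"
    by simp
  then show ?case by (rule reaches_le) (use k in auto)
qed

lemma query_phase:
  "reaches (dstep M D H) (2 ^ m * (2 * m + 3))
     (3, t0 # wtape (bit_word (lsb_bits m 0 @ pad)) 0 # t2 # wtape (replicate m 1) 0 #
         wtape [] 0 # ts)
     (11, t0 # wtape (bit_word (lsb_bits m (2 ^ m) @ pad)) (int m) # t2 #
         wtape (replicate m 1) (int m) #
        wtape (bit_word (map (\<lambda>j. H (lsb_bits m j @ pad)) [0..<2 ^ m]) @ [sep]) (int (2 ^ m + 1)) # ts)"
proof -
  \<comment> \<open>The last point \<open>2 ^ m - 1\<close> is treated apart from the loop, as its
    increment overflows and leads to the separator instead of a rewind.\<close>
  obtain i where i: "Suc i = 2 ^ m" by (metis Suc_pred zero_less_numeral zero_less_power)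
  let ?tt = "\<lambda>i. map (\<lambda>j. H (lsb_bits m j @ pad)) [0..<i]"
  let ?t4 = "wtape (bit_word (?tt (Suc i))) (int (Suc i))"
  have q: "reaches (dstep M D H) 2
     (3, t0 # wtape (bit_word (lsb_bits m i @ pad)) 0 # t2 # wtape (replicate m 1) 0 #
        wtape (bit_word (?tt i)) (int i) # ts)
     (10, t0 # wtape (bit_word (lsb_bits m i @ pad)) 0 # t2 # wtape (replicate m 1) 0 # ?t4 # ts)"
    using query_step [of M D H t0 "lsb_bits m i @ pad" 0 t2 "wtape (replicate m 1) 0" "?tt i" ts]
        by simp
  have c: "reaches (dstep M D H) m
     (10, t0 # wtape (bit_word (lsb_bits m i @ pad)) 0 # t2 # wtape (replicate m 1) 0 # ?t4 # ts)
     (10, t0 # wtape (bit_word (lsb_bits m (Suc i) @ pad)) (int m) # t2 #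
        wtape (replicate m 1) (int m) # ?t4 # ts)"
    using counter_increment [of i m "[]" m M D H t0 pad t2 ?t4 ts] i by auto
  have "dstep M D H (10, t0 # wtape (bit_word (lsb_bits m (Suc i) @ pad)) (int m) # t2 #
        wtape (replicate m 1) (int m) # ?t4 # ts) =
      (11, t0 # wtape (bit_word (lsb_bits m (Suc i) @ pad)) (int m) # t2 #
          wtape (replicate m 1) (int m) #
        wtape (bit_word (?tt (Suc i)) @ [sep]) (int (Suc i + 1)) # ts)"
    using cell_simps(2) [of "replicate m 1"] act_append [of sep Move_Right "bit_word (?tt (Suc i))"]
    by (simp add: dstep_control control_def Let_def add.commute)
  from reaches_trans [OF query_loop reaches_trans [OF q reaches_trans [OF c reaches_step [where f = "dstep M D H", OF this reaches_refl]]]]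
  have "reaches (dstep M D H) (i * (2 * m + 3) + (2 + (m + Suc 0)))
     (3, t0 # wtape (bit_word (lsb_bits m 0 @ pad)) 0 # t2 # wtape (replicate m 1) 0 #
         wtape [] 0 # ts)
      (11, t0 # wtape (bit_word (lsb_bits m (Suc i) @ pad)) (int m) # t2 #
          wtape (replicate m 1) (int m) #
        wtape (bit_word (?tt (Suc i)) @ [sep]) (int (Suc i + 1)) # ts)"
    using i by (metis lessI)
  moreover have "i * (2 * m + 3) + (2 + (m + Suc 0)) \<le> 2 ^ m * (2 * m + 3)"
    unfolding i [symmetric] by simp
  ultimately show ?thesis unfolding i by (rule reaches_le)
qed

text \<open>Each zero written consumes three marks. As 3 divides \<open>m\<close>, the head meets
  the left blank exactly in state 12.\<close>

lemma write_threshold: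
  assumes "m = 3 * e" "j \<le> e"
  shows "reaches (dstep M D H) (3 * j)
     (12, t0 # t1 # t2 # wtape (replicate m 1) (int m - 1) # wtape w (int (length w)) # ts)
     (12, t0 # t1 # t2 # wtape (replicate m 1) (int m - 1 - 3 * int j) #
        wtape (w @ replicate j 1) (int (length w + j)) # ts)"
  using assms(2)
proof (induction j)
  case 0
  show ?case using reaches_refl by simp
next
  case (Suc j)
  let ?p = "int m - 1 - 3 * int j" and ?t3 = "\<lambda>p. wtape (replicate m 1) p"
  let ?t4 = "\<lambda>j. wtape (w @ replicate j 1) (int (length w + j))"
  have "?p = int (m - 1 - 3 * j)" "m - 1 - 3 * j < m" using Suc.prems assms(1) by auto
  then have "cell (replicate m 1) ?p = 1" by (metis cell_simps(3) length_replicate nth_replicate)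
  then have "dstep M D H (12, t0 # t1 # t2 # ?t3 ?p # ?t4 j # ts) =
      (13, t0 # t1 # t2 # ?t3 (?p - 1) # ?t4 (Suc j) # ts)"
    using act_append [of 1 Move_Right "w @ replicate j 1"]
    by (simp add: dstep_control control_def Let_def replicate_append_same ac_simps)
  moreover have "dstep M D H (13, t0 # t1 # t2 # ?t3 (?p - 1) # ?t4 (Suc j) # ts) =
      (14, t0 # t1 # t2 # ?t3 (?p - 1 - 1) # ?t4 (Suc j) # ts)"
    by (simp add: dstep_control control_def Let_def add.commute)
  moreover have "dstep M D H (14, t0 # t1 # t2 # ?t3 (?p - 1 - 1) # ?t4 (Suc j) # ts) =
      (12, t0 # t1 # t2 # ?t3 (?p - 1 - 1 - 1) # ?t4 (Suc j) # ts)"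
    by (simp add: dstep_control control_def Let_def add.commute)
  moreover have "?p - 1 - 1 - 1 = int m - 1 - 3 * int (Suc j)" by simp
  ultimately have "reaches (dstep M D H) 3
      (12, t0 # t1 # t2 # ?t3 ?p # ?t4 j # ts)
      (12, t0 # t1 # t2 # ?t3 (int m - 1 - 3 * int (Suc j)) # ?t4 (Suc j) # ts)"
    by (metis reaches_refl reaches_step numeral_3_eq_3)
  from reaches_trans [OF Suc.IH this] show ?case using Suc.prems by (simp add: add.commute)
qed

lemma machine_rewind:
  assumes "\<And>a. a \<in> set w \<Longrightarrow> a \<noteq> blank" "k \<le> length w"
  shows "reaches (dstep M D H) (Suc k)
     (15, t0 # t1 # t2 # t3 # wtape w (int k - 1) # ts) (16 + D, t0 # t1 # t2 # t3 # wtape w 0 #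
         ts)"
  using assms(2)
proof (induction k)
  case 0
  show ?case by (rule reaches_step [OF _ reaches_refl]) (simp add: dstep_simps)
next
  case (Suc k)
  show ?case
    by (rule reaches_step [OF _ Suc.IH]) (use Suc.prems nonblank_cell [OF assms(1)] in \<open>auto simp: dstep_simps\<close>)
qed

text \<open>Halting states are their own codes and all other codes lie above the control and query
  states, so steps correspond one to one, also after \<open>M\<close> has halted.\<close>

lemma dstep_simulation:
  "dstep M D H (embed_state D (fst c), t0 # t1 # t2 # t3 # snd c) =
     (embed_state D (fst (tm_step M c)), t0 # t1 # t2 # t3 # snd (tm_step M c))"
  by (auto simp: dstep_def potm_step_def tm_step_def halted_def embed_state_def apply_transition_def
      distinguisher_def dist_delta_def Let_def numeral_eq_Suc split: prod.splits)

lemma simulation: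
  "(dstep M D H ^^ t) (16 + D, t0 # t1 # t2 # t3 # wtape w 0 #
      replicate (ntapes M - 1) (input_tape [])) =
     (embed_state D (fst (tm_run M t w)), t0 # t1 # t2 # t3 # snd (tm_run M t w))"
proof (induction t)
  case 0
  show ?case by (simp add: tm_run_def init_config_def embed_state_def input_tape_wtape)
next
  case (Suc t)
  then show ?case by (simp add: dstep_simulation tm_run_Suc)
qed

text \<open>The variables after the first \<open>m\<close> are set to zero. The outer
  \<open>restrict\<close> makes the result extensional, as membership in \<open>bool_funs m\<close>
  requires.\<close>

definition oracle_restriction :: "nat \<Rightarrow> nat \<Rightarrow> (bool list \<Rightarrow> bool) \<Rightarrow> bool list \<Rightarrow> bool" where
  "oracle_restriction n m H = restrict (\<lambda>z. H (z @ replicate (n - m) False)) (cube m)"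

lemma distinguisher_input:
  assumes "D = 3 * c" "m = D * length (bits (length w))" "e = c * length (bits (length w))" "0 < c"
    and "0 < ntapes M"
  shows "\<exists>t0 t1 t2 t3. reaches (dstep M D H)
     (2 * (length w + 2) ^ 2 + 2 ^ m * (2 * m + 4) + 6 * m + 10)
     (init_config (4 + ntapes M) (bit_word w))
     (16 + D, t0 # t1 # t2 # t3 #
         wtape (MC_TT_input m (oracle_restriction (max (length w) m) m H) (2 ^ e)) 0 #
        replicate (ntapes M - 1) (input_tape []))"
proof -
  define S where "S = dstep M D H"
  define n L where "n = length w" and "L = length (bits n)"
  define ts where "ts = replicate (ntapes M - 1) (input_tape [])"
  \<comment> \<open>On short inputs \<open>m\<close> may exceed \<open>n\<close>; the queries then
    have length \<open>m\<close> and carry no padding.\<close>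
  define N where "N = max n m"
  define pad where "pad = replicate (N - m) False"
  define tt where "tt = map (\<lambda>j. H (lsb_bits m j @ pad)) [0..<2 ^ m]"
  define v where "v = bit_word tt @ [sep] @ [2] @ replicate e 1"
  let ?t0 = "wtape (bit_word w) (int n)" and ?r = "bit_word (bits n)" and ?e = "wtape [] 0"
  have m: "m = D * L" "m = 3 * e" and D: "0 < D" using assms by (auto simp: L_def n_def)
  have r: "length ?r = L" by (simp add: L_def)

  have init: "init_config (4 + ntapes M) (bit_word w) = (0, wtape (bit_word w) 0 # ?e # ?e # ?e #
      ?e # ts)"
  proof -
    obtain K where "ntapes M = Suc K" using assms(5) gr0_implies_Suc by blast
    then show ?thesis by (simp add: init_config_def ts_def input_tape_wtape numeral_eq_Suc)
  qed
  have scan: "reaches S (n * (2 * n + 4)) (0, wtape (bit_word w) 0 # ?e # ?e # ?e # ?e # ts)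
     (0, ?t0 # wtape (replicate n 1) (int n) # wtape ?r 0 # ?e # ?e # ts)"
    unfolding S_def n_def by (rule scan_input) simp
  have scan_end: "reaches S 1 (0, ?t0 # wtape (replicate n 1) (int n) # wtape ?r 0 # ?e # ?e # ts)
     (8, ?t0 # wtape (replicate n 1) (int n - 1) # wtape ?r 0 # ?e # ?e # ts)"
    using cell_simps(2) [of "bit_word w"]
    by (intro reaches_1) (simp add: S_def dstep_control control_def Let_def n_def)
  have rewind: "reaches S (Suc n) (8, ?t0 # wtape (replicate n 1) (int n - 1) # wtape ?r 0 # ?e #
      ?e # ts)
     (16, ?t0 # wtape (replicate n 1) 0 # wtape ?r 0 # ?e # ?e # ts)"
    unfolding S_def by (rule query_rewind) auto
  have expand: "reaches S m (16, ?t0 # wtape (replicate n 1) 0 # wtape ?r 0 # ?e # ?e # ts)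
     (16, ?t0 # wtape (replicate N 1) (int m) # wtape ?r (int L) # wtape (replicate m 1) (int m) #
         ?e # ts)"
    using expand_ruler [of ?r D m M H ?t0 n ?e ts] bit_word_nonblank D m(1) r
        by (simp add: S_def N_def)
  have expand_end: "reaches S 1
     (16, ?t0 # wtape (replicate N 1) (int m) # wtape ?r (int L) # wtape (replicate m 1) (int m) #
         ?e # ts)
     (9, ?t0 # wtape (replicate N 1) (int m - 1) # wtape ?r (int L) #
         wtape (replicate m 1) (int m - 1) # ?e # ts)"
    using cell_simps(2) [of ?r] D
    by (intro reaches_1) (simp add: S_def dstep_control control_def Let_def r [symmetric])
  have zero: "replicate N 1 = bit_word (lsb_bits m 0 @ pad)"
    by (simp add: lsb_bits_0 pad_def N_def replicate_add [symmetric])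
  have counter: "reaches S (Suc m)
     (9, ?t0 # wtape (replicate N 1) (int m - 1) # wtape ?r (int L) #
         wtape (replicate m 1) (int m - 1) # ?e # ts)
     (3, ?t0 # wtape (bit_word (lsb_bits m 0 @ pad)) 0 # wtape ?r (int L) #
         wtape (replicate m 1) 0 # ?e # ts)"
    unfolding S_def zero by (rule counter_rewind) auto
  let ?t1 = "wtape (bit_word (lsb_bits m (2 ^ m) @ pad)) (int m)" and ?t2 = "wtape ?r (int L)"
  have query: "reaches S (2 ^ m * (2 * m + 3))
     (3, ?t0 # wtape (bit_word (lsb_bits m 0 @ pad)) 0 # wtape ?r (int L) #
         wtape (replicate m 1) 0 # ?e # ts)
     (11, ?t0 # ?t1 # ?t2 # wtape (replicate m 1) (int m) #
         wtape (bit_word tt @ [sep]) (int (2 ^ m + 1)) # ts)"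
    unfolding S_def tt_def by (rule query_phase)
  have len: "length (bit_word tt @ [sep]) = 2 ^ m + 1" by (simp add: tt_def)
  have "dstep M D H
     (11, ?t0 # ?t1 # ?t2 # wtape (replicate m 1) (int m) #
        wtape (bit_word tt @ [sep]) (int (length (bit_word tt @ [sep]))) # ts) =
     (12, ?t0 # ?t1 # ?t2 # wtape (replicate m 1) (int m - 1) #
        wtape (bit_word tt @ [sep] @ [2]) (int (length (bit_word tt @ [sep] @ [2]))) # ts)"
    using act_append [of 2 Move_Right "bit_word tt @ [sep]"]
    by (simp add: dstep_control control_def Let_def)
  then have leading: "reaches S 1
     (11, ?t0 # ?t1 # ?t2 # wtape (replicate m 1) (int m) #
         wtape (bit_word tt @ [sep]) (int (2 ^ m + 1)) # ts)
     (12, ?t0 # ?t1 # ?t2 # wtape (replicate m 1) (int m - 1) #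
        wtape (bit_word tt @ [sep] @ [2]) (int (length (bit_word tt @ [sep] @ [2]))) # ts)"
    unfolding S_def len by (rule reaches_1)
  have threshold: "reaches S (3 * e)
     (12, ?t0 # ?t1 # ?t2 # wtape (replicate m 1) (int m - 1) #
        wtape (bit_word tt @ [sep] @ [2]) (int (length (bit_word tt @ [sep] @ [2]))) # ts)
     (12, ?t0 # ?t1 # ?t2 # wtape (replicate m 1) (-1) # wtape v (int (length v)) # ts)"
    using write_threshold [OF m(2) le_refl, of M D H ?t0 ?t1 ?t2 "bit_word tt @ [sep] @ [2]" ts] m(2)
    by (simp add: S_def v_def)
  have threshold_end: "reaches S 1
     (12, ?t0 # ?t1 # ?t2 # wtape (replicate m 1) (-1) # wtape v (int (length v)) # ts)
     (15, ?t0 # ?t1 # ?t2 # wtape (replicate m 1) (-1) # wtape v (int (length v) - 1) # ts)"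
    by (intro reaches_1) (simp add: S_def dstep_control control_def Let_def)
  have machine: "reaches S (Suc (length v))
     (15, ?t0 # ?t1 # ?t2 # wtape (replicate m 1) (-1) # wtape v (int (length v) - 1) # ts)
     (16 + D, ?t0 # ?t1 # ?t2 # wtape (replicate m 1) (-1) # wtape v 0 # ts)"
    unfolding S_def
    by (rule machine_rewind) (use bit_word_nonblank in \<open>auto simp: v_def\<close>)
  have "reaches S (n * (2 * n + 4) + (1 + (Suc n + (m + (1 + (Suc m + (2 ^ m * (2 * m + 3) +
        (1 + (3 * e + (1 + Suc (length v)))))))))))
     (0, wtape (bit_word w) 0 # ?e # ?e # ?e # ?e # ts)
     (16 + D, ?t0 # ?t1 # ?t2 # wtape (replicate m 1) (-1) # wtape v 0 # ts)"
    by (intro reaches_trans [OF scan] reaches_trans [OF scan_end] reaches_trans [OF rewind]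
        reaches_trans [OF expand] reaches_trans [OF expand_end] reaches_trans [OF counter]
        reaches_trans [OF query] reaches_trans [OF leading] reaches_trans [OF threshold]
        reaches_trans [OF threshold_end] machine)
  moreover have "n * (2 * n + 4) + (1 + (Suc n + (m + (1 + (Suc m + (2 ^ m * (2 * m + 3) +
        (1 + (3 * e + (1 + Suc (length v)))))))))) \<le>
      2 * (length w + 2) ^ 2 + 2 ^ m * (2 * m + 4) + 6 * m + 10"
    using m(2) by (simp add: v_def tt_def n_def power2_eq_square algebra_simps)
  ultimately have run: "reaches S (2 * (length w + 2) ^ 2 + 2 ^ m * (2 * m + 4) + 6 * m + 10)
     (init_config (4 + ntapes M) (bit_word w))
     (16 + D, ?t0 # ?t1 # ?t2 # wtape (replicate m 1) (-1) # wtape v 0 # ts)"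
    unfolding init by (rule reaches_le)
  have "truth_table m (oracle_restriction N m H) = tt"
    by (simp add: truth_table_def n_lists_lsb_bits tt_def oracle_restriction_def pad_def cube_def)
  then have "MC_TT_input m (oracle_restriction N m H) (2 ^ e) = v"
    by (simp add: MC_TT_input_def binary_power v_def)
  then show ?thesis using run unfolding S_def N_def n_def ts_def by blast
qed

lemma distinguisher_run:
  assumes "D = 3 * c" "m = D * length (bits (length w))" "e = c * length (bits (length w))" "0 < c"
    and "0 < ntapes M"
    and ans: "answers_within M T (MC_TT_input m (oracle_restriction (max (length w) m) m H) (2 ^ e)) b"
  shows "\<exists>t \<le> 2 * (length w + 2) ^ 2 + 2 ^ m * (2 * m + 4) + 6 * m + 10 + T.
    halted ((dstep M D H ^^ t) (init_config (4 + ntapes M) (bit_word w))) \<and>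
    (accepting ((dstep M D H ^^ t) (init_config (4 + ntapes M) (bit_word w))) \<longleftrightarrow> b)"
proof -
  let ?v = "MC_TT_input m (oracle_restriction (max (length w) m) m H) (2 ^ e)"
  let ?c = "init_config (4 + ntapes M) (bit_word w)"
  obtain t u where t: "t \<le> 2 * (length w + 2) ^ 2 + 2 ^ m * (2 * m + 4) + 6 * m + 10"
    and "(dstep M D H ^^ (T + t)) ?c = (embed_state D (fst (tm_run M T ?v)), u)"
    using distinguisher_input [OF assms(1-5), of H] simulation [of T M D H]
    unfolding reaches_def by (auto simp: funpow_add)
  then show ?thesis using ans
    by (intro exI [of _ "T + t"])
      (auto simp: answers_within_def halted_def accepting_def embed_state_def)
qed


section \<open>The advantage of the distinguisher\<close>

text \<open>Both transition functions are \<open>dist_delta M D\<close>, so the run is deterministic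
  and its distribution a point mass.\<close>

lemma potm_run_distinguisher:
  "potm_run (distinguisher M D) H t w =
     return_pmf ((dstep M D H ^^ t) (init_config (4 + ntapes M) (bit_word w)))"
proof -
  have "potm_step (distinguisher M D) H coin c = dstep M D H c" for coin c
    by (simp add: dstep_def potm_step_def distinguisher_def)
  then show ?thesis
    by (induction t) (simp_all add: potm_run_def bind_return_pmf map_pmf_const, simp add: distinguisher_def)
qed

lemma dstep_halted: "halted c \<Longrightarrow> (dstep M D H ^^ t) c = c"
  by (induction t) (simp_all add: dstep_def potm_step_def)

lemma dstep_halted_le: "halted ((dstep M D H ^^ t) c) \<Longrightarrow> t \<le> u \<Longrightarrow> (dstep M D H ^^ u) c =
    (dstep M D H ^^ t) c"
  using dstep_halted [of "(dstep M D H ^^ t) c" "u - t" M D H]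
  by (metis add.commute funpow_add le_add_diff_inverse o_apply)

text \<open>Halted configurations persist: comparing the runs at times \<open>t\<close> and
  \<open>T\<close> with the one at \<open>max t T\<close> shows that acceptance at any time implies
  acceptance at \<open>T\<close>. The supremum is therefore attained at \<open>T\<close>.\<close>

lemma accept_prob_distinguisher:
  assumes "\<And>H. halted ((dstep M D H ^^ T) (init_config (4 + ntapes M) (bit_word w)))"
    and "\<And>H. accepting ((dstep M D H ^^ T) (init_config (4 + ntapes M) (bit_word w))) \<longleftrightarrow> b H"
  shows "accept_prob (distinguisher M D) HD w = measure_pmf.prob HD {H. b H}"
proof -
  let ?run = "\<lambda>t H. (dstep M D H ^^ t) (init_config (4 + ntapes M) (bit_word w))"
  have prob: "measure_pmf.prob (bind_pmf HD (\<lambda>H. potm_run (distinguisher M D) H t w)) {c. accepting c} =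
      measure_pmf.prob HD {H. accepting (?run t H)}" for t
    by (simp add: potm_run_distinguisher map_pmf_def [symmetric] vimage_def)
  have "accepting (?run t H) \<Longrightarrow> b H" for t H
  proof -
    assume acc: "accepting (?run t H)"
    then have "halted (?run t H)" by (simp add: accepting_def halted_def)
    then have "?run (max t T) H = ?run t H" "?run (max t T) H = ?run T H"
      using assms(1) dstep_halted_le by (metis max.cobounded1, metis max.cobounded2)
    then show "b H" using acc assms(2) by metis
  qed
  then have le: "measure_pmf.prob HD {H. accepting (?run t H)} \<le> measure_pmf.prob HD {H. b H}" for t
    by (intro measure_pmf.finite_measure_mono) auto
  have eq: "measure_pmf.prob HD {H. accepting (?run T H)} = measure_pmf.prob HD {H. b H}"
    by (simp add: assms(2))
  have "(SUP t. measure_pmf.prob HD {H. accepting (?run t H)}) = measure_pmf.prob HD {H. b H}"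
  proof (rule cSup_eq_maximum)
    show "measure_pmf.prob HD {H. b H} \<in> range (\<lambda>t. measure_pmf.prob HD {H. accepting (?run t H)})"
      by (rule range_eqI [where x = T], rule eq [symmetric])
  qed (use le in auto)
  then show ?thesis by (simp add: accept_prob_def prob)
qed

lemma oracle_restriction_bool_funs: "oracle_restriction n m H \<in> bool_funs m"
  by (simp add: oracle_restriction_def bool_funs_def)

lemma mult_complexity_cong:
  assumes "\<And>x. x \<in> cube n \<Longrightarrow> f x = g x"
  shows "mult_complexity n f = mult_complexity n g"
  using assms by (simp add: mult_complexity_def computes_def)

lemma finite_cube [simp]: "finite (cube n)" and card_cube [simp]: "card (cube n) = 2 ^ n"
  using finite_lists_length_eq [of "UNIV :: bool set" n] card_lists_length_eq [of "UNIV :: bool set" n]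
  by (auto simp: cube_def)

lemma finite_bool_funs [simp]: "finite (bool_funs n)" and card_bool_funs: "card (bool_funs n) =
    2 ^ 2 ^ n"
  by (simp_all add: bool_funs_def finite_PiE card_PiE)

lemma cube_nonempty [simp]: "cube n \<noteq> {}" and bool_funs_nonempty [simp]: "bool_funs n \<noteq> {}"
  using card_cube [of n] card_bool_funs [of n]
      by (metis card.empty power_not_zero zero_neq_numeral)+

section \<open>Restricting a random function\<close>

text \<open>A function is determined by its restriction and its values off the subcube
  \<open>E\<close>, so each restriction has at most \<open>2 ^ (2 ^ n - 2 ^ m)\<close> extensions.
  This bounds the probability that a random restriction falls into \<open>S\<close>, stated without
  division.\<close>

lemma card_restriction_le:
  assumes "m \<le> n" and "S \<subseteq> bool_funs m"
  shows "card {g \<in> bool_funs n. oracle_restriction n m (oracle_of n g) \<in> S} * 2 ^ 2 ^ m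
    \<le> card S * 2 ^ 2 ^ n"
proof -
  define E where "E = (\<lambda>z. z @ replicate (n - m) False) ` cube m"
  define G where "G = {g \<in> bool_funs n. oracle_restriction n m (oracle_of n g) \<in> S}"
  define R where "R = (cube n - E \<rightarrow>\<^sub>E (UNIV :: bool set))"
  have E: "E \<subseteq> cube n" using assms(1) by (auto simp: E_def cube_def)
  have "card E = 2 ^ m" unfolding E_def by (subst card_image) (auto intro: inj_onI)
  then have cardR: "card R = 2 ^ (2 ^ n - 2 ^ m)" and finR: "finite R"
    using E by (simp_all add: R_def card_PiE finite_PiE card_Diff_subset finite_subset)
  have "inj_on (\<lambda>g. (oracle_restriction n m (oracle_of n g), restrict g (cube n - E))) G"
  proof (rule inj_onI)
    fix g h assume gh: "g \<in> G" "h \<in> G" and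
      eq: "(oracle_restriction n m (oracle_of n g), restrict g (cube n - E)) =
         (oracle_restriction n m (oracle_of n h), restrict h (cube n - E))"
    have "g x = h x" if x: "x \<in> cube n" for x
    proof (cases "x \<in> E")
      case True
      then obtain z where z: "z \<in> cube m" "x = z @ replicate (n - m) False" by (auto simp: E_def)
      have "oracle_restriction n m (oracle_of n g) z = oracle_restriction n m (oracle_of n h) z"
        using eq by simp
      then show ?thesis using z x by (simp add: oracle_restriction_def oracle_of_def)
    next
      case False
      have "restrict g (cube n - E) x = restrict h (cube n - E) x" using eq by simp
      then show ?thesis using x False by simp
    qed
    then show "g = h" using gh unfolding G_def bool_funs_def by (auto intro: PiE_ext)
  qed
  moreover have "(\<lambda>g. (oracle_restriction n m (oracle_of n g), restrict g (cube n - E))) ` G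
      \<subseteq> S \<times> R"
    by (auto simp: G_def R_def)
  moreover have "finite S" using assms(2) finite_bool_funs finite_subset by blast
  ultimately have "card G \<le> card (S \<times> R)"
    using finR by (intro card_inj_on_le) auto
  then have "card G * 2 ^ 2 ^ m \<le> card S * (2 ^ (2 ^ n - 2 ^ m) * 2 ^ 2 ^ m)"
    by (simp add: card_cartesian_product cardR mult.assoc [symmetric])
  also have "(2 :: nat) ^ (2 ^ n - 2 ^ m) * 2 ^ 2 ^ m = 2 ^ 2 ^ n"
    using assms(1) by (simp add: power_add [symmetric])
  finally show ?thesis by (simp add: G_def)
qed

section \<open>Growth estimates\<close>

lemma square_le_two_power: "4 \<le> n \<Longrightarrow> n ^ 2 \<le> (2 :: nat) ^ n"
proof (induction n rule: nat_induct_at_least)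
  case (Suc n)
  have "2 * n + 1 \<le> n ^ 2" using mult_le_mono1 [OF Suc.hyps, of n] Suc.hyps
      unfolding power2_eq_square by linarith
  then show ?case using Suc.IH by (simp add: power2_eq_square)
qed simp

lemma length_bits_ge: "2 ^ t \<le> n \<Longrightarrow> t \<le> length (bits n)"
proof (rule ccontr)
  assume "2 ^ t \<le> n" "\<not> t \<le> length (bits n)"
  then have "(2 :: nat) ^ length (bits n) \<le> 2 ^ t" by (intro power_increasing) auto
  then show False using less_two_power_bits [of n] \<open>2 ^ t \<le> n\<close> by linarith
qed

text \<open>The hypothesis gives the counter length \<open>L\<close> at least
  \<open>4 * k + 4\<close>: the part \<open>4 * k\<close> yields
  \<open>4 * k * L \<le> L * L\<close>, and the part 4 yields \<open>L * L \<le> 2 ^ L\<close>,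
  which is at most \<open>2 * n + 1\<close>.\<close>

lemma mult_length_bits_le:
  assumes "2 ^ (4 * k + 4) \<le> n"
  shows "k * length (bits n) \<le> n"
proof -
  define L where "L = length (bits n)"
  have L: "4 * k + 4 \<le> L" using length_bits_ge [OF assms] by (simp add: L_def)
  then have "4 * k * L \<le> L * L" by (intro mult_le_mono1) simp
  also have "L * L \<le> 2 ^ L" using square_le_two_power [of L] L by (simp add: power2_eq_square)
  also have "\<dots> \<le> 2 * n + 1" unfolding L_def by (rule two_power_bits_le)
  finally show ?thesis by (simp add: L_def)
qed

lemma poly_le_power: "\<exists>c N. \<forall>n \<ge> N. poly (q :: nat poly) n \<le> n ^ c"
proof (induction q)
  case 0
  then show ?case by auto
next
  case (pCons a q)
  then obtain c N where cN: "\<And>n. N \<le> n \<Longrightarrow> poly q n \<le> n ^ c" by blast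
  \<comment> \<open>One extra factor \<open>n\<close> comes from the shift of the coefficients, the
    other absorbs the factor 2 left by adding \<open>a\<close>.\<close>
  have "poly (pCons a q) n \<le> n ^ (c + 2)" if "max N (a + 2) \<le> n" for n
  proof -
    have n: "N \<le> n" "a \<le> n" "2 \<le> n" using that by auto
    have "n \<le> n * n ^ c" using n by simp
    then have "poly (pCons a q) n \<le> 2 * (n * n ^ c)"
      using cN [OF n(1)] n(2) mult_le_mono2 [of "poly q n" "n ^ c" n] unfolding poly_pCons
          by linarith
    also have "\<dots> \<le> n * (n * n ^ c)" using n(3) by (intro mult_le_mono1)
    finally show ?thesis by simp
  qed
  then show ?case by blast
qed

text \<open>The finitely many values below the asymptotic range go into \<open>B\<close>. A bound
  for all \<open>n\<close> is required because the distinguisher must be polynomial on every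
  input.\<close>

lemma exponential_bound:
  fixes g :: "nat \<Rightarrow> real"
  assumes "g \<in> O(\<lambda>n. real n)" and "\<And>n. real (T n) \<le> 2 powr g n"
  shows "\<exists>B C. \<forall>n. T n \<le> B * (2 ^ n) ^ C"
proof -
  obtain c where "\<forall>\<^sub>F n in sequentially. norm (g n) \<le> c * norm (real n)"
    using landau_o.bigE [OF assms(1)] by blast
  then obtain N where c: "\<And>n. N \<le> n \<Longrightarrow> \<bar>g n\<bar> \<le> c * real n"
    by (auto simp: eventually_sequentially)
  define C where "C = nat \<lceil>c\<rceil>"
  define B where "B = 1 + (\<Sum>i<N. T i)"
  have "T n \<le> B * (2 ^ n) ^ C" for n
  proof (cases "n < N")
    case True
    then have "T n \<le> B" using member_le_sum [of n "{..<N}" T] by (simp add: B_def)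
    then show ?thesis
        by (metis le_trans mult.right_neutral mult_le_mono2 one_le_numeral one_le_power)
  next
    case False
    have "g n \<le> c * real n" using c [of n] False by auto
    also have "\<dots> \<le> real C * real n" by (intro mult_right_mono) (auto simp: C_def, linarith)
    finally have "real (T n) \<le> 2 powr (real C * real n)"
      using assms(2) [of n] powr_mono [of "g n" "real C * real n" 2] by linarith
    also have "\<dots> = real ((2 ^ n) ^ C)"
      by (simp add: powr_realpow [symmetric] powr_powr mult.commute)
    finally have "T n \<le> (2 ^ n) ^ C" by linarith
    also have "\<dots> \<le> B * (2 ^ n) ^ C" by (simp add: B_def)
    finally show ?thesis .
  qed
  then show ?thesis by blast
qed

text \<open>With \<open>s = 2 ^ e\<close>, the condition \<open>4 \<le> e\<close> gives both
  \<open>16 \<le> s\<close> and \<open>Suc m \<le> s\<close>, so the exponent of the count plus 1 is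
  at most \<open>16 * s ^ 2\<close>, hence at most \<open>s ^ 3 = 2 ^ m\<close>. The added 1 pays
  for the factor 2, that is, for probability one half.\<close>

lemma few_easy_functions:
  assumes "4 \<le> e" "m = 3 * e"
  shows "2 * card {f \<in> bool_funs m. mult_complexity m f \<le> 2 ^ e} \<le> 2 ^ 2 ^ m"
proof -
  define s :: nat where "s = 2 ^ e"
  have "e ^ 2 \<le> s" using square_le_two_power assms(1) by (simp add: s_def)
  moreover have "4 * e \<le> e ^ 2" using assms(1) by (simp add: power2_eq_square)
  ultimately have m: "Suc m \<le> s" using assms by simp
  have "(2 :: nat) ^ 4 \<le> s" unfolding s_def using assms(1) by (intro power_increasing) auto
  then have s: "16 \<le> s" by simp
  have "(2 * s + 1) * (Suc m + s) + 1 \<le> (2 * s + 1) * (2 * s) + 1"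
    using m by (intro add_le_mono mult_le_mono) auto
  also have "(2 * s + 1) * (2 * s) + 1 = 4 * (s * s) + 2 * s + 1" by (simp add: algebra_simps)
  also have "\<dots> \<le> 16 * (s * s)" using mult_le_mono1 [OF s, of s] s by linarith
  also have "\<dots> \<le> s * (s * s)" using s by (intro mult_le_mono1)
  also have "\<dots> = 2 ^ m" unfolding s_def assms(2) by (simp add: power_add [symmetric])
  finally have le: "(2 * s + 1) * (Suc m + s) + 1 \<le> 2 ^ m" .
  have "2 * card {f \<in> bool_funs m. mult_complexity m f \<le> s} \<le> 2 ^ ((2 * s + 1) * (Suc m + s) + 1)"
    using card_mult_complexity_le [of m s] by simp
  also have "\<dots> \<le> 2 ^ 2 ^ m" using le by (intro power_increasing) auto
  finally show ?thesis by (simp add: s_def)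
qed

lemma distinguisher_halts:
  assumes dec: "decides_MC_TT M T" and T: "\<And>n. T n \<le> B * (2 ^ n) ^ C" and "0 < c"
  shows "\<exists>p :: nat poly. \<forall>w H.
    halted ((dstep M (3 * c) H ^^ poly p (length w)) (init_config (4 + ntapes M) (bit_word w))) \<and>
    (accepting ((dstep M (3 * c) H ^^ poly p (length w)) (init_config (4 + ntapes M) (bit_word w))) \<longleftrightarrow>
      (let m = 3 * c * length (bits (length w)) in
       mult_complexity m (oracle_restriction (max (length w) m) m H) \<le>
           2 ^ (c * length (bits (length w)))))"
proof -
  \<comment> \<open>\<open>Y\<close> dominates \<open>2 ^ m\<close>, because the counter length
    \<open>L\<close> satisfies \<open>2 ^ L \<le> 2 * n + 1\<close> and
    \<open>m = 3 * c * L\<close>. The last term of \<open>p\<close> then bounds the time of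
    \<open>M\<close> on a truth table of \<open>m\<close> variables.\<close>
  define Y :: "nat poly" where "Y = [:1, 2:] ^ (3 * c)"
  define p :: "nat poly" where "p =
      [:2:] * [:2, 1:] ^ 2 + Y * ([:2:] * Y + [:4:]) + [:6:] * Y + [:10:] + [:B:] * Y ^ C"
  have K: "0 < ntapes M" using dec by (simp add: decides_MC_TT_def tm_wf_def)
  have "halted ((dstep M (3 * c) H ^^ poly p (length w)) (init_config (4 + ntapes M) (bit_word w))) \<and>
    (accepting ((dstep M (3 * c) H ^^ poly p (length w)) (init_config (4 + ntapes M) (bit_word w))) \<longleftrightarrow>
       mult_complexity m (oracle_restriction (max (length w) m) m H) \<le>
           2 ^ (c * length (bits (length w))))"
    if m: "m = 3 * c * length (bits (length w))" for w H m
  proof -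
    define n where "n = length w"
    define y where "y = poly Y n"
    have "2 ^ m = ((2 :: nat) ^ length (bits n)) ^ (3 * c)"
      by (simp add: m n_def power_mult [symmetric] mult.commute)
    also have "\<dots> \<le> (2 * n + 1) ^ (3 * c)" by (intro power_mono two_power_bits_le) simp
    also have "\<dots> = y" by (simp add: y_def Y_def mult.commute)
    finally have y: "2 ^ m \<le> y" .
    then have my: "m \<le> y" using less_exp [of m] by linarith
    have "2 ^ m * (2 * m + 4) \<le> y * (2 * y + 4)" using y my by (intro mult_le_mono) auto
    moreover have "T m \<le> B * y ^ C" using T [of m] y
        by (meson le_trans mult_le_mono2 power_mono zero_le)
    ultimately have time: "2 * (length w + 2) ^ 2 + 2 ^ m * (2 * m + 4) + 6 * m + 10 + T m \<le>
        poly p (length w)"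
      using my by (simp add: p_def y_def n_def add.commute)
    have "answers_within M (T m) (MC_TT_input m (oracle_restriction (max (length w) m) m H)
        (2 ^ (c * length (bits (length w)))))
        (mult_complexity m (oracle_restriction (max (length w) m) m H) \<le>
            2 ^ (c * length (bits (length w))))"
      using dec oracle_restriction_bool_funs by (simp add: decides_MC_TT_def)
    from distinguisher_run [OF refl m refl \<open>0 < c\<close> K this]
    obtain t where t: "t \<le> poly p (length w)"
      "halted ((dstep M (3 * c) H ^^ t) (init_config (4 + ntapes M) (bit_word w)))"
      "accepting ((dstep M (3 * c) H ^^ t) (init_config (4 + ntapes M) (bit_word w))) \<longleftrightarrow>
        mult_complexity m (oracle_restriction (max (length w) m) m H) \<le>
            2 ^ (c * length (bits (length w)))"
      using time le_trans by blast
    then show ?thesis using dstep_halted_le [OF t(2,1)] by simp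
  qed
  then show ?thesis by (auto simp: Let_def)
qed

theorem theorem1:
  assumes "\<exists>f. pseudorandom_family f"
  shows "\<not> (\<exists>M T (g :: nat \<Rightarrow> real). g \<in> O(\<lambda>n. real n) \<and> (\<forall>n. real (T n) \<le> 2 powr g n) \<and>
               decides_MC_TT M T)"
proof
  assume "\<exists>M T (g :: nat \<Rightarrow> real). g \<in> O(\<lambda>n. real n) \<and> (\<forall>n. real (T n) \<le>
      2 powr g n) \<and> decides_MC_TT M T"
  then obtain M T B C where dec: "decides_MC_TT M T" and T: "\<And>n. T n \<le> B * (2 ^ n) ^ C"
    using exponential_bound by metis
  obtain f where f: "pseudorandom_family f" using assms by blast
  then have "polytime_family f" by (simp add: pseudorandom_family_def)
  then obtain M0 and p0 :: "nat poly" where M0: "tm_wf M0" and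
    ans: "\<And>n k x. k \<in> cube n \<Longrightarrow> x \<in> cube n \<Longrightarrow>
      answers_within M0 (poly p0 n) (map bit_sym k @ [sep] @ map bit_sym x) (f n k x)"
    unfolding polytime_family_def by blast
  obtain c0 N0 where c0: "\<And>n. N0 \<le> n \<Longrightarrow>
      poly (p0 * ([:step_cost M0:] * ([:2:] * p0 + [:1:]))) n \<le> n ^ c0"
    using poly_le_power by blast
  \<comment> \<open>The exponent depends on the family only. The successor keeps it positive, so the
    distinguisher has at least one mark per ruler cell and \<open>e\<close> is at least the counter
    length.\<close>
  define c where "c = Suc c0"
  define A where "A = distinguisher M (3 * c)"
  define b where "b n H \<longleftrightarrow> (let m = 3 * c * length (bits n) in
    mult_complexity m (oracle_restriction (max n m) m H) \<le> 2 ^ (c * length (bits n)))" for n H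
  obtain p :: "nat poly" where
    halts: "\<And>w H. halted ((dstep M (3 * c) H ^^ poly p (length w)) (init_config (4 + ntapes M) (bit_word w)))" and
    acc: "\<And>w H. accepting ((dstep M (3 * c) H ^^ poly p (length w)) (init_config (4 + ntapes M) (bit_word w))) \<longleftrightarrow>
      b (length w) H"
    using distinguisher_halts [OF dec T, of c] unfolding b_def c_def by blast
  have "polytime_potm A"
    unfolding polytime_potm_def A_def
  proof (intro conjI exI [of _ p] allI ballI)
    show "potm_wf (distinguisher M (3 * c))"
      using dec by (intro distinguisher_wf) (auto simp: decides_MC_TT_def c_def)
    show "halted d" if "d \<in> set_pmf (potm_run (distinguisher M (3 * c)) H (poly p (length w)) w)"
        for w H d
      using that halts by (simp add: potm_run_distinguisher)
  qed
  then have "superpoly_small (advantage f A)" using f by (simp add: pseudorandom_family_def)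
  then obtain h :: "nat \<Rightarrow> real" where h: "filterlim h at_top sequentially"
    and small: "\<forall>\<^sub>F n in sequentially. advantage f A n \<le> real n powr (- h n)"
    by (auto simp: superpoly_small_def)
  have accept: "accept_prob A HD (replicate n True) = measure_pmf.prob HD {H. b n H}" for HD n
    unfolding A_def using halts [of "replicate n True"] acc [of "replicate n True"]
    by (intro accept_prob_distinguisher) simp_all
  \<comment> \<open>The second bound on \<open>n\<close> is the one of
    \<open>mult_length_bits_le\<close> for \<open>k = 3 * c\<close>: it ensures
    \<open>m \<le> n\<close>, so queries have exactly length \<open>n\<close>, and a counter length
    of at least 4.\<close>
  have large: "1 / 2 \<le> advantage f A n"
    if n: "N0 \<le> n" "2 ^ (4 * (3 * c) + 4) \<le> n" for n
  proof -
    define L m e where "L = length (bits n)" and "m = 3 * c * L" and "e = c * L"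
    have mn: "m \<le> n" using mult_length_bits_le [OF n(2)] by (simp add: m_def L_def)
    then have max: "max n m = n" by simp
    have "4 \<le> L" using length_bits_ge [OF n(2)] by (simp add: L_def)
    then have e: "4 \<le> e" using le_trans [of 4 L e] by (simp add: e_def c_def)
    have b: "b n H \<longleftrightarrow> mult_complexity m (oracle_restriction n m H) \<le> 2 ^ e" for H
      using max by (simp add: b_def Let_def m_def e_def L_def)
    have "b n (oracle_of n (f n k))" if k: "k \<in> cube n" for k
    proof -
      have "mult_complexity m (oracle_restriction n m (oracle_of n (f n k))) =
          mult_complexity m (\<lambda>z. f n k (z @ replicate (n - m) False))"
        using mn
            by (intro mult_complexity_cong) (auto simp: oracle_restriction_def oracle_of_def cube_def)
      also have "\<dots> \<le> poly p0 n * (step_cost M0 * (2 * poly p0 n + 1))"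
        by (rule mult_complexity_restricted_family [OF M0 k mn]) (rule ans [OF k])
      also have "\<dots> \<le> n ^ c0" using c0 [OF n(1)] by (simp add: algebra_simps)
      also have "\<dots> \<le> (2 ^ L) ^ c0" using less_two_power_bits [of n]
          by (intro power_mono) (auto simp: L_def)
      also have "\<dots> \<le> 2 ^ e" by (simp add: power_mult [symmetric] e_def c_def mult.commute)
      finally show ?thesis by (simp add: b)
    qed
    \<comment> \<open>Every key leads to acceptance, so the probability is exactly 1 and the gap to
      the random case is at least one half.\<close>
    then have pseudo: "measure_pmf.prob (map_pmf (\<lambda>k. oracle_of n (f n k)) (pmf_of_set (cube n))) {H. b n H} = 1"
      by (subst measure_pmf.prob_eq_1) (auto simp: AE_measure_pmf_iff)
    define S where "S = {f \<in> bool_funs m. mult_complexity m f \<le> 2 ^ e}"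
    have "card {g \<in> bool_funs n. b n (oracle_of n g)} * 2 ^ 2 ^ m \<le> card S * 2 ^ 2 ^ n"
    proof -
      have "S \<subseteq> bool_funs m"
        "{g \<in> bool_funs n. b n (oracle_of n g)} =
          {g \<in> bool_funs n. oracle_restriction n m (oracle_of n g) \<in> S}"
        using oracle_restriction_bool_funs by (auto simp: S_def b)
      then show ?thesis using card_restriction_le [OF mn, of S] by simp
    qed
    then have "2 * card {g \<in> bool_funs n. b n (oracle_of n g)} * 2 ^ 2 ^ m \<le> 2 * card S * 2 ^ 2 ^ n"
      by simp
    also have "\<dots> \<le> 2 ^ 2 ^ m * 2 ^ 2 ^ n"
      unfolding S_def by (intro mult_le_mono1 few_easy_functions e) (simp add: m_def e_def)
    finally have "2 * card {g \<in> bool_funs n. b n (oracle_of n g)} \<le> card (bool_funs n)"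
      by (simp add: card_bool_funs)
    then have "2 * real (card {g \<in> bool_funs n. b n (oracle_of n g)}) \<le> real (card (bool_funs n))"
      by linarith
    moreover have "0 < card (bool_funs n)" by (simp add: card_gt_0_iff)
    ultimately have "real (card {g
        \<in> bool_funs n. b n (oracle_of n g)}) / real (card (bool_funs n)) \<le> 1 / 2"
      by (simp add: divide_le_eq)
    then have random: "measure_pmf.prob (map_pmf (oracle_of n) (pmf_of_set (bool_funs n))) {H. b n H} \<le> 1 / 2"
      by (simp add: measure_pmf_of_set vimage_def Collect_conj_eq [symmetric] Int_def)
    show ?thesis using pseudo random by (simp add: advantage_def accept)
  qed
  \<comment> \<open>An exponent of 1 already suffices: for \<open>n\<close> at least 3 the advantage
    would be at most \<open>1 / n\<close>, which is below one half.\<close>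
  have "\<forall>\<^sub>F n in sequentially. 1 \<le> h n" using h by (simp add: filterlim_at_top)
  then have "\<forall>\<^sub>F n in sequentially. False"
    using small eventually_ge_at_top [of "max 3 (max N0 (2 ^ (4 * (3 * c) + 4)))"]
  proof eventually_elim
    case (elim n)
    have n: "3 \<le> n" "1 / 2 \<le> advantage f A n" using elim(3) large by auto
    have "real n powr (- h n) \<le> real n powr (- 1)" using elim(1) n(1) by (intro powr_mono) auto
    also have "\<dots> = 1 / real n" using n(1) by (simp add: powr_minus divide_inverse)
    also have "\<dots> < 1 / 2" using n(1) by (simp add: divide_simps)
    finally show ?case using elim(2) n(2) by linarith
  qed
  then show False by simp
qed

end
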